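(* Let $k\ge1$, $\mathbf{a}_1,\dots,\mathbf{a}_k\in\mathbb{S}^{n-1}$, $\mathbf{b}\in\mathbb{S}^{k-1}$, let $\sigma(z)=\frac{1}{1+e^{-z}}$ be the sigmoid, and let $\sigma':\mathbb{R}\to[0,1]$ be a known $L$-Lipschitz non-decreasing function. Define $\mathcal{N}_2(\mathbf{x})=\sigma'\big(\sum_{i=1}^k \mathbf{b}_i\,\sigma(\mathbf{a}_i\cdot\mathbf{x})\big)$. Let $\mathcal{D}$ be any distribution on $\mathbb{S}^{n-1}\times[0,1]$ with $\mathbb{E}[y\mid\mathbf{x}]=\mathcal{N}_2(\mathbf{x})$, and let $(\mathbf{x}_i,y_i)_{i=1}^m$ be drawn i.i.d. from $\mathcal{D}$. There exists an algorithm that outputs a hypothesis $h$ such that, with probability $1-\delta$, \[\mathbb{E}_{(\mathbf{x},y)\sim\mathcal{D}}\left[(h(\mathbf{x})-\mathcal{N}_2(\mathbf{x}))^2\right]\le\epsilon\] for $m=\left(\frac{kL}{\epsilon}\right)^{O(1)}\cdot\log(1/\delta)$. The algorithm runs in time polynomial in $m$ and $n$.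
   Context: $\mathbb{S}^{n-1}$ denotes the unit sphere in $\mathbb{R}^n$; the weights $\mathbf{a}_i,\mathbf{b}$ are unknown.
   Formalization: The exponent O(1) in m is uniform only over δ bounded away from 1: for each δ₀<1 one exponent serves all δ≤δ₀, because with a single exponent for all δ in (0,1) the bound would permit m=1 as δ→1 and the claim fails. *)

theory Defs
  imports "HOL-Probability.Probability"
begin

section \<open>Networks and distributions\<close>

text \<open>
  The dimension has to range inside the statement, because a single algorithm serves every
  dimension. Vectors in \<open>\<real>\<^sup>n\<close> are therefore functions on \<open>nat\<close> that are extensional
  on \<open>{..<n}\<close>, i.e. points of the product space \<open>vec_space n\<close>.
\<close>

type_synonym vec = "nat \<Rightarrow> real"
type_synonym sample = "nat \<Rightarrow> vec \<times> real"

definition vec_space :: "nat \<Rightarrow> vec measure" where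
  "vec_space n = PiM {..<n} (\<lambda>_. borel)"

definition inner_prod :: "nat \<Rightarrow> vec \<Rightarrow> vec \<Rightarrow> real" where
  "inner_prod n a x = (\<Sum>j<n. a j * x j)"

definition unit_sphere :: "nat \<Rightarrow> vec set" where
  "unit_sphere n = {x \<in> extensional {..<n}. (\<Sum>j<n. (x j)\<^sup>2) = 1}"

definition sigmoid :: "real \<Rightarrow> real" where
  "sigmoid z = 1 / (1 + exp (- z))"

definition net2 :: "(real \<Rightarrow> real) \<Rightarrow> nat \<Rightarrow> nat \<Rightarrow> (nat \<Rightarrow> vec) \<Rightarrow> vec \<Rightarrow> vec \<Rightarrow> real" where
  "net2 u n k a b x = u (\<Sum>i<k. b i * sigmoid (inner_prod n (a i) x))"

definition activation :: "real \<Rightarrow> (real \<Rightarrow> real) \<Rightarrow> bool" where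
  "activation L u \<longleftrightarrow> range u \<subseteq> {0..1} \<and> L-lipschitz_on UNIV u \<and> mono u"

definition example_space :: "nat \<Rightarrow> (vec \<times> real) measure" where
  "example_space n = vec_space n \<Otimes>\<^sub>M borel"

definition labelled_distribution :: "nat \<Rightarrow> (vec \<times> real) measure \<Rightarrow> bool" where
  "labelled_distribution n D \<longleftrightarrow>
     prob_space D \<and> sets D = sets (example_space n) \<and> (AE z in D. z \<in> unit_sphere n \<times> {0..1})"

text \<open>\<open>E[y | x] = f x\<close>: conditioning on the sigma-algebra generated by the first component.\<close>

definition conditional_mean :: "nat \<Rightarrow> (vec \<times> real) measure \<Rightarrow> (vec \<Rightarrow> real) \<Rightarrow> bool" where
  "conditional_mean n D f \<longleftrightarrow>
     (AE z in D. real_cond_exp D (vimage_algebra (space D) fst (vec_space n)) snd z = f (fst z))"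

section \<open>Algorithms\<close>

text \<open>
  A real RAM as a while language with an explicit step count. Real registers and array
  cells hold exact reals; arithmetic, comparison and evaluation of a fixed function \<open>u\<close>
  (the oracle \<open>ROracle\<close>) are primitive. Program constants are integers, so a program cannot
  carry real-valued advice, and there is no conversion from reals to naturals. Naturals serve
  as counters and array indices and have no multiplication.

  One step is charged for every assignment, test and \<open>Skip\<close>. The expressions occurring in
  a program have a fixed size, so counting their operations individually would change running
  times only by a constant factor depending on the program.
\<close>

type_synonym vname = string

record state =
  nats :: "vname \<Rightarrow> nat"
  reals :: "vname \<Rightarrow> real"
  arrays :: "vname \<Rightarrow> nat \<Rightarrow> real"

datatype nexp = NConst nat | NVar vname | NPlus nexp nexp | NMinus nexp nexp

datatype rexp =
    RConst int | RVar vname | RCell vname nexp | ROfNat nexp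
  | RPlus rexp rexp | RMinus rexp rexp | RTimes rexp rexp | RDivide rexp rexp | ROracle rexp

datatype bexp = NLess nexp nexp | RLess rexp rexp | BNot bexp | BAnd bexp bexp

datatype com =
    Skip
  | NAssign vname nexp
  | RAssign vname rexp
  | CellAssign vname nexp rexp
  | Seq com com
  | Cond bexp com com
  | While bexp com

fun nval :: "nexp \<Rightarrow> state \<Rightarrow> nat" where
  "nval (NConst c) s = c"
| "nval (NVar v) s = nats s v"
| "nval (NPlus e f) s = nval e s + nval f s"
| "nval (NMinus e f) s = nval e s - nval f s"

fun rval :: "(real \<Rightarrow> real) \<Rightarrow> rexp \<Rightarrow> state \<Rightarrow> real" where
  "rval u (RConst c) s = of_int c"
| "rval u (RVar v) s = reals s v"
| "rval u (RCell v e) s = arrays s v (nval e s)"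
| "rval u (ROfNat e) s = real (nval e s)"
| "rval u (RPlus e f) s = rval u e s + rval u f s"
| "rval u (RMinus e f) s = rval u e s - rval u f s"
| "rval u (RTimes e f) s = rval u e s * rval u f s"
| "rval u (RDivide e f) s = rval u e s / rval u f s"
| "rval u (ROracle e) s = u (rval u e s)"

fun bval :: "(real \<Rightarrow> real) \<Rightarrow> bexp \<Rightarrow> state \<Rightarrow> bool" where
  "bval u (NLess e f) s \<longleftrightarrow> nval e s < nval f s"
| "bval u (RLess e f) s \<longleftrightarrow> rval u e s < rval u f s"
| "bval u (BNot c) s \<longleftrightarrow> \<not> bval u c s"
| "bval u (BAnd c d) s \<longleftrightarrow> bval u c s \<and> bval u d s"

text \<open>\<open>exec u c s t s'\<close>: started in \<open>s\<close>, the program \<open>c\<close> halts in \<open>s'\<close> after exactly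
  \<open>t\<close> steps.\<close>

inductive exec :: "(real \<Rightarrow> real) \<Rightarrow> com \<Rightarrow> state \<Rightarrow> nat \<Rightarrow> state \<Rightarrow> bool" for u where
  Skip: "exec u Skip s 1 s"
| NAssign: "exec u (NAssign v e) s 1 (s\<lparr>nats := (nats s)(v := nval e s)\<rparr>)"
| RAssign: "exec u (RAssign v e) s 1 (s\<lparr>reals := (reals s)(v := rval u e s)\<rparr>)"
| CellAssign: "exec u (CellAssign v i e) s 1
    (s\<lparr>arrays := (arrays s)(v := (arrays s v)(nval i s := rval u e s))\<rparr>)"
| Seq: "exec u c s t s' \<Longrightarrow> exec u d s' t' s'' \<Longrightarrow> exec u (Seq c d) s (t + t') s''"
| CondTrue: "bval u g s \<Longrightarrow> exec u c s t s' \<Longrightarrow> exec u (Cond g c d) s (t + 1) s'"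
| CondFalse: "\<not> bval u g s \<Longrightarrow> exec u d s t s' \<Longrightarrow> exec u (Cond g c d) s (t + 1) s'"
| WhileFalse: "\<not> bval u g s \<Longrightarrow> exec u (While g c) s 1 s"
| WhileTrue: "bval u g s \<Longrightarrow> exec u c s t s' \<Longrightarrow> exec u (While g c) s' t' s'' \<Longrightarrow>
    exec u (While g c) s (t + t' + 1) s''"

lemma exec_deterministic:
  "exec u c s t s' \<Longrightarrow> exec u c s r s'' \<Longrightarrow> r = t \<and> s'' = s'"
proof (induction arbitrary: r s'' rule: exec.induct)
  case Skip
  then show ?case by (cases rule: exec.cases) auto
next
  case NAssign
  then show ?case by (cases rule: exec.cases) auto
next
  case RAssign
  then show ?case by (cases rule: exec.cases) auto
next
  case CellAssign
  then show ?case by (cases rule: exec.cases) auto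
next
  case Seq
  from Seq.prems show ?case by (cases rule: exec.cases) (use Seq.IH in blast)
next
  case CondTrue
  from CondTrue.prems show ?case by (cases rule: exec.cases) (use CondTrue.IH CondTrue.hyps in blast)+
next
  case CondFalse
  from CondFalse.prems show ?case by (cases rule: exec.cases) (use CondFalse.IH CondFalse.hyps in blast)+
next
  case WhileFalse
  from WhileFalse.prems show ?case by (cases rule: exec.cases) (use WhileFalse.hyps in auto)
next
  case WhileTrue
  from WhileTrue.prems show ?case by (cases rule: exec.cases) (use WhileTrue.IH WhileTrue.hyps in blast)+
qed

section \<open>Learning\<close>

text \<open>
  A learner reads the sample together with the parameters and leaves a finite list of reals,
  the cells of array \<open>rep\<close> below index \<open>len\<close>, which represents its hypothesis. The hypothesis
  is the function that the evaluator program computes from this list. The weights of the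
  network occur in neither input; both programs have \<open>u\<close> as oracle, since \<open>u\<close> is known.
  The sample points are stored in array \<open>x\<close> row by row.
\<close>

definition learner_input ::
    "nat \<Rightarrow> nat \<Rightarrow> real \<Rightarrow> real \<Rightarrow> real \<Rightarrow> nat \<Rightarrow> sample \<Rightarrow> state" where
  "learner_input n k L \<epsilon> \<delta> m S =
     \<lparr>nats = (\<lambda>_. 0)(''n'' := n, ''k'' := k, ''m'' := m),
      reals = (\<lambda>_. 0)(''L'' := L, ''eps'' := \<epsilon>, ''delta'' := \<delta>),
      arrays = (\<lambda>_ _. 0)
        (''x'' := (\<lambda>i. if i < m * n then fst (S (i div n)) (i mod n) else 0),
         ''y'' := (\<lambda>i. if i < m then snd (S i) else 0))\<rparr>"

definition learner_output :: "state \<Rightarrow> real list" where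
  "learner_output s = map (arrays s ''rep'') [0..<nats s ''len'']"

definition evaluator_input :: "nat \<Rightarrow> real list \<Rightarrow> vec \<Rightarrow> state" where
  "evaluator_input n w x =
     \<lparr>nats = (\<lambda>_. 0)(''n'' := n, ''len'' := length w),
      reals = (\<lambda>_. 0),
      arrays = (\<lambda>_ _. 0)
        (''x'' := (\<lambda>j. if j < n then x j else 0),
         ''rep'' := (\<lambda>i. if i < length w then w ! i else 0))\<rparr>"

definition evaluator_output :: "state \<Rightarrow> real" where
  "evaluator_output s = reals s ''out''"

text \<open>On the sample \<open>S\<close> the learner outputs the hypothesis \<open>h\<close>, and \<open>T\<close> bounds its
  running time, the size of its output and the time of each evaluation of \<open>h\<close>.\<close>

definition outputs_hypothesis ::
    "com \<Rightarrow> com \<Rightarrow> (real \<Rightarrow> real) \<Rightarrow> nat \<Rightarrow> nat \<Rightarrow> real \<Rightarrow> real \<Rightarrow> real \<Rightarrow> nat \<Rightarrow> sample \<Rightarrow>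
     nat \<Rightarrow> (vec \<Rightarrow> real) \<Rightarrow> bool" where
  "outputs_hypothesis learner evaluator u n k L \<epsilon> \<delta> m S T h \<longleftrightarrow>
     (\<exists>t s. exec u learner (learner_input n k L \<epsilon> \<delta> m S) t s \<and> t \<le> T \<and>
        length (learner_output s) \<le> T \<and>
        (\<forall>x\<in>unit_sphere n. \<exists>t' s'.
           exec u evaluator (evaluator_input n (learner_output s) x) t' s' \<and> t' \<le> T \<and>
           h x = evaluator_output s'))"

text \<open>The integrability requirement is needed because the Bochner integral of a
  non-integrable function is 0.\<close>

definition mean_square_error_le ::
    "(vec \<times> real) measure \<Rightarrow> (vec \<Rightarrow> real) \<Rightarrow> (vec \<Rightarrow> real) \<Rightarrow> real \<Rightarrow> bool" where
  "mean_square_error_le D h f \<epsilon> \<longleftrightarrow>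
     integrable D (\<lambda>z. (h (fst z) - f (fst z))\<^sup>2) \<and>
     (\<integral>z. (h (fst z) - f (fst z))\<^sup>2 \<partial>D) \<le> \<epsilon>"

end

theory Submission
  imports Defs "HOL-Complex_Analysis.Complex_Analysis" "HOL-Probability.Hoeffding"
begin

text \<open>
  The poles of the sigmoid closest to 0 are \<open>\<plusminus>i\<pi>\<close>, outside the disc of radius \<open>sqrt 2\<close>. So on the
  sphere the inner layer is an element \<open>v\<close> of the reproducing kernel Hilbert space of
  \<open>K x y = 1 / (1 - x\<cdot>y / 2)\<close> with \<open>\<parallel>v\<parallel>\<^sup>2 = O(k)\<close>, exactly and not only approximately. The learner
  makes one pass of the update \<open>w := w + \<lambda> (y - u (w x)) K x\<close> over blocks of \<open>T = O(k L\<^sup>2 / \<epsilon>\<^sup>2)\<close>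
  samples, restarting from \<open>w = 0\<close> in every block, and predicts with the average of \<open>u \<circ> w\<close> over
  all iterates. As \<open>u\<close> is monotone and \<open>L\<close>-Lipschitz, every step decreases \<open>\<parallel>w - v\<parallel>\<^sup>2\<close> in expectation
  by \<open>2\<lambda>/L\<close> times the current squared error, up to \<open>2\<lambda>\<^sup>2\<close>. Hence the errors of a block have mean at
  most \<open>\<epsilon>/2\<close> in expectation. The blocks are independent, so Hoeffding's inequality gives the
  confidence, and convexity of the square passes to the averaged predictor.

  If \<open>9 L\<^sup>2 k \<le> 16 \<epsilon>\<close>, the constant \<open>u 0\<close> is good enough and the learner uses \<open>\<lambda> = 0\<close>. Otherwise
  \<open>k L / \<epsilon> > 4/3\<close> (for \<open>\<epsilon> < 1\<close>), so that constant factors are absorbed by the exponent of the sample bound.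
\<close>

section \<open>The sigmoid in a reproducing kernel Hilbert space\<close>

text \<open>The zeros are the odd multiples of \<open>\<i> * pi\<close>, and the nearest of them lie
  at distance \<open>pi\<close> from 0.\<close>

lemma one_plus_exp_nonzero:
  fixes z :: complex
  assumes "norm z < pi"
  shows "1 + exp (- z) \<noteq> 0"
proof
  assume "1 + exp (- z) = 0"
  hence "exp (- z) = exp (\<i> * of_real pi)"
    by (simp add: exp_pi_i' add_eq_0_iff mult.commute)
  then obtain j :: int where "- z = \<i> * of_real pi + (of_int (2 * j) * pi) * \<i>"
    using exp_eq by metis
  hence "Im (- z) = pi * (1 + 2 * of_int j)"
    by (simp add: algebra_simps)
  hence "\<bar>Im z\<bar> = pi * \<bar>1 + 2 * of_int j\<bar>"
    by (simp add: abs_mult flip: abs_minus_cancel[of "Im z"])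
  moreover have "(1::real) \<le> \<bar>of_int (1 + 2 * j)\<bar>"
  proof -
    have "1 \<le> \<bar>1 + 2 * j\<bar>" by presburger
    thus ?thesis by linarith
  qed
  ultimately have "\<bar>Im z\<bar> \<ge> pi"
    using pi_gt_zero by (simp add: mult_le_cancel_left1)
  with assms abs_Im_le_cmod[of z] show False by linarith
qed

text \<open>The Taylor series at 0 has radius of convergence at least \<open>pi\<close>, which
  exceeds \<open>sqrt 2\<close>. The weight \<open>2 ^ d\<close> is the one that the Hilbert norm of
  \<open>kernel\<close> puts on degree \<open>d\<close>, so the first sum is the squared norm of a
  single neuron, up to constants.\<close>

lemma sigmoid_power_series:
  "\<exists>c :: nat \<Rightarrow> real. summable (\<lambda>d. (c d)\<^sup>2 * 2 ^ d) \<and>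
     (\<forall>z. \<bar>z\<bar> \<le> 1 \<longrightarrow> (\<lambda>d. c d * z ^ d) sums sigmoid z)"
proof -
  let ?f = "\<lambda>z::complex. 1 / (1 + exp (- z))"
  define e where "e d = (deriv ^^ d) ?f 0 / fact d" for d
  have "?f holomorphic_on ball 0 pi"
    using one_plus_exp_nonzero by (intro holomorphic_intros) auto
  hence ser: "(\<lambda>d. e d * z ^ d) sums ?f z" if "norm z < pi" for z
    using holomorphic_power_series[of ?f 0 pi z] that by (simp add: e_def)
  have "summable (\<lambda>d. norm (e d * 2 ^ d))"
  proof (rule powser_insidea)
    \<comment> \<open>The point 3 lies strictly between 2 and \<open>pi\<close>: convergence there
      gives absolute convergence at 2.\<close>
    show "summable (\<lambda>d. e d * 3 ^ d)"
      using ser[of 3] pi_gt3 by (auto simp: sums_iff)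
  qed simp
  hence lim: "(\<lambda>d. norm (e d * 2 ^ d)) \<longlonglongrightarrow> 0"
    by (rule summable_LIMSEQ_zero)
  have "summable (\<lambda>d. (Re (e d))\<^sup>2 * 2 ^ d)"
  proof (rule summable_comparison_test_ev)
    show "summable (\<lambda>d. (1/2::real) ^ d)" by (simp add: summable_geometric)
    have "\<forall>\<^sub>F d in sequentially. norm (e d * 2 ^ d) < 1"
      using lim by (rule order_tendstoD) simp
    thus "\<forall>\<^sub>F d in sequentially. norm ((Re (e d))\<^sup>2 * 2 ^ d) \<le> (1 / 2) ^ d"
    proof eventually_elim
      case (elim d)
      \<comment> \<open>Splitting \<open>2 ^ d\<close> as \<open>4 ^ d / 2 ^ d\<close> puts the
        square of a null sequence next to a summable geometric factor.\<close>
      have "norm ((Re (e d))\<^sup>2 * 2 ^ d) = (\<bar>Re (e d)\<bar> * 2 ^ d)\<^sup>2 * (1 / 2) ^ d"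
        by (simp add: power_mult_distrib power_divide power2_eq_square)
      also have "\<dots> \<le> (norm (e d * 2 ^ d))\<^sup>2 * (1 / 2) ^ d"
        using abs_Re_le_cmod[of "e d"]
        by (intro mult_right_mono power_mono) (auto simp: norm_mult norm_power)
      also have "\<dots> \<le> 1 * (1 / 2) ^ d"
        using elim by (intro mult_right_mono) (auto simp: power_le_one)
      finally show ?case by simp
    qed
  qed
  \<comment> \<open>Taking real parts of the complex series at real arguments yields real
    coefficients at once.\<close>
  moreover have "(\<lambda>d. Re (e d) * z ^ d) sums sigmoid z" if "\<bar>z\<bar> \<le> 1" for z
  proof -
    have "(\<lambda>d. e d * complex_of_real z ^ d) sums ?f (of_real z)"
      using that pi_gt3 by (intro ser) auto
    hence "(\<lambda>d. Re (e d * complex_of_real z ^ d)) sums Re (?f (of_real z))"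
      by (rule sums_Re)
    moreover have "?f (of_real z) = of_real (sigmoid z)"
      by (simp add: sigmoid_def exp_of_real flip: of_real_minus)
    ultimately show ?thesis by (simp flip: of_real_power)
  qed
  ultimately show ?thesis by (intro exI[of _ "\<lambda>d. Re (e d)"]) simp
qed

text \<open>The expression is the squared norm of the difference of the tensors \<Sum> \<alpha>
  x^{\<otimes>d} and \<Sum> \<beta> a^{\<otimes>d}. The induction splits one factor off each tensor:
  for every coordinate \<open>l\<close> the hypothesis is applied with that coordinate absorbed into
  the coefficients, which is why these are generalised.\<close>

lemma inner_power_psd:
  fixes \<alpha> :: "'i \<Rightarrow> real" and \<beta> :: "'j \<Rightarrow> real"
  assumes "finite I" "finite J"
  shows "0 \<le> (\<Sum>s\<in>I. \<Sum>t\<in>I. \<alpha> s * \<alpha> t * inner_prod n (x s) (x t) ^ d)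
            - 2 * (\<Sum>s\<in>I. \<Sum>j\<in>J. \<alpha> s * \<beta> j * inner_prod n (a j) (x s) ^ d)
            + (\<Sum>i\<in>J. \<Sum>j\<in>J. \<beta> i * \<beta> j * inner_prod n (a i) (a j) ^ d)"
proof (induction d arbitrary: \<alpha> \<beta>)
  case 0
  have "(\<Sum>s\<in>I. \<Sum>t\<in>I. \<alpha> s * \<alpha> t) - 2 * (\<Sum>s\<in>I. \<Sum>j\<in>J. \<alpha> s * \<beta> j) + (\<Sum>i\<in>J. \<Sum>j\<in>J. \<beta> i * \<beta> j)
      = ((\<Sum>s\<in>I. \<alpha> s) - (\<Sum>j\<in>J. \<beta> j))\<^sup>2"
    by (simp add: power2_eq_square algebra_simps sum_product)
  then show ?case by simp
next
  case (Suc d)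
  have A: "(\<Sum>s\<in>I. \<Sum>t\<in>I. \<alpha> s * \<alpha> t * inner_prod n (x s) (x t) ^ Suc d)
     = (\<Sum>l<n. \<Sum>s\<in>I. \<Sum>t\<in>I. (\<alpha> s * x s l) * (\<alpha> t * x t l) * inner_prod n (x s) (x t) ^ d)"
    by (subst sum.swap, rule sum.cong[OF refl], subst sum.swap, rule sum.cong[OF refl])
      (simp add: inner_prod_def sum_distrib_left sum_distrib_right mult_ac)
  have B: "(\<Sum>s\<in>I. \<Sum>j\<in>J. \<alpha> s * \<beta> j * inner_prod n (a j) (x s) ^ Suc d)
     = (\<Sum>l<n. \<Sum>s\<in>I. \<Sum>j\<in>J. (\<alpha> s * x s l) * (\<beta> j * a j l) * inner_prod n (a j) (x s) ^ d)"
    by (subst sum.swap, rule sum.cong[OF refl], subst sum.swap, rule sum.cong[OF refl])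
      (simp add: inner_prod_def sum_distrib_left sum_distrib_right mult_ac)
  have C: "(\<Sum>i\<in>J. \<Sum>j\<in>J. \<beta> i * \<beta> j * inner_prod n (a i) (a j) ^ Suc d)
     = (\<Sum>l<n. \<Sum>i\<in>J. \<Sum>j\<in>J. (\<beta> i * a i l) * (\<beta> j * a j l) * inner_prod n (a i) (a j) ^ d)"
    by (subst sum.swap, rule sum.cong[OF refl], subst sum.swap, rule sum.cong[OF refl])
      (simp add: inner_prod_def sum_distrib_left sum_distrib_right mult_ac)
  show ?case
    unfolding A B C
    using sum_nonneg[of "{..<n}", OF Suc.IH[of "\<lambda>s. \<alpha> s * x s _" "\<lambda>j. \<beta> j * a j _"]]
    by (simp add: sum.distrib sum_subtractf sum_distrib_left)
qed

section \<open>The kernel and the inner layer on the sphere\<close>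

lemma sum_abs_le_sqrt_card:
  assumes "b \<in> unit_sphere k"
  shows "(\<Sum>j<k. \<bar>b j\<bar>)\<^sup>2 \<le> real k"
proof -
  have "(\<Sum>j<k. \<bar>b j\<bar> * 1)\<^sup>2 \<le> (\<Sum>j<k. \<bar>b j\<bar>\<^sup>2) * (\<Sum>j<k. 1\<^sup>2)"
    by (rule Cauchy_Schwarz_ineq_sum)
  with assms show ?thesis by (simp add: unit_sphere_def)
qed

lemma abs_inner_prod_le_1:
  assumes "a \<in> unit_sphere n" "x \<in> unit_sphere n"
  shows "\<bar>inner_prod n a x\<bar> \<le> 1"
proof -
  have "(inner_prod n a x)\<^sup>2 \<le> (\<Sum>j<n. (a j)\<^sup>2) * (\<Sum>j<n. (x j)\<^sup>2)"
    unfolding inner_prod_def by (rule Cauchy_Schwarz_ineq_sum)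
  with assms have "(inner_prod n a x)\<^sup>2 \<le> 1" by (simp add: unit_sphere_def)
  thus ?thesis by (simp add: abs_square_le_1)
qed

text \<open>Clipping has no effect on the sphere, and makes the kernel bounded everywhere.\<close>

definition kernel :: "nat \<Rightarrow> vec \<Rightarrow> vec \<Rightarrow> real" where
  "kernel n x y = 2 / (2 - max (- 1) (min 1 (inner_prod n x y)))"

lemma kernel_sphere:
  assumes "x \<in> unit_sphere n" "y \<in> unit_sphere n"
  shows "kernel n x y = 2 / (2 - inner_prod n x y)"
  using abs_inner_prod_le_1[OF assms] by (auto simp: kernel_def max_def min_def)

lemma kernel_sums:
  assumes "x \<in> unit_sphere n" "y \<in> unit_sphere n"
  shows "(\<lambda>d. inner_prod n x y ^ d / 2 ^ d) sums kernel n x y"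
proof -
  have "(\<lambda>d. (inner_prod n x y / 2) ^ d) sums (1 / (1 - inner_prod n x y / 2))"
    using abs_inner_prod_le_1[OF assms] by (intro geometric_sums) auto
  also have "1 / (1 - inner_prod n x y / 2) = kernel n x y"
    using abs_inner_prod_le_1[OF assms] by (simp add: kernel_sphere assms divide_simps)
  finally show ?thesis by (simp add: power_divide)
qed

lemma kernel_pos: "0 < kernel n x y" and kernel_le_2: "kernel n x y \<le> 2"
  by (auto simp: kernel_def max_def min_def divide_simps)

lemma inner_prod_commute: "inner_prod n x y = inner_prod n y x"
  by (simp add: inner_prod_def mult.commute)

lemma kernel_commute: "kernel n x y = kernel n y x"
  by (simp add: kernel_def inner_prod_commute)

definition inner_layer :: "nat \<Rightarrow> nat \<Rightarrow> (nat \<Rightarrow> vec) \<Rightarrow> vec \<Rightarrow> vec \<Rightarrow> real" where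
  "inner_layer n k a b x = (\<Sum>i<k. b i * sigmoid (inner_prod n (a i) x))"

text \<open>The right-hand side bounds the squared distance, in the Hilbert space of \<^const>\<open>kernel\<close>, between
  \<open>\<Sum>\<^sub>s \<alpha>\<^sub>s K (x\<^sub>s)\<close> and the inner layer. Degree by degree it is a squared distance between tensors.\<close>

lemma inner_layer_rkhs:
  fixes T :: nat
  assumes c: "summable (\<lambda>d. (c d)\<^sup>2 * 2 ^ d)"
    "\<And>z. \<bar>z\<bar> \<le> 1 \<Longrightarrow> (\<lambda>d. c d * z ^ d) sums sigmoid z"
    and a: "\<And>i. i < k \<Longrightarrow> a i \<in> unit_sphere n" and b: "b \<in> unit_sphere k"
    and x: "\<And>s. s < T \<Longrightarrow> x s \<in> unit_sphere n"
  shows "0 \<le> (\<Sum>s<T. \<Sum>t<T. \<alpha> s * \<alpha> t * kernel n (x s) (x t))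
     - 2 * (\<Sum>s<T. \<alpha> s * inner_layer n k a b (x s)) + (\<Sum>d. (c d)\<^sup>2 * 2 ^ d) * real k"
proof (rule sums_le)
  show "(\<lambda>d. 0) sums (0::real)" by simp
  \<comment> \<open>\<open>F d\<close> is the degree-\<open>d\<close> part of the right-hand side.
    In its last term the Gram sum of the weights is already replaced by its upper bound
    \<open>k\<close>.\<close>
  define F where "F d = (\<Sum>s<T. \<Sum>t<T. \<alpha> s * \<alpha> t * (inner_prod n (x s) (x t) ^ d / 2 ^ d))
     - 2 * (\<Sum>s<T. \<alpha> s * (\<Sum>i<k. b i * (c d * inner_prod n (a i) (x s) ^ d)))
     + ((c d)\<^sup>2 * 2 ^ d) * real k" for d
  show "F sums ((\<Sum>s<T. \<Sum>t<T. \<alpha> s * \<alpha> t * kernel n (x s) (x t))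
     - 2 * (\<Sum>s<T. \<alpha> s * inner_layer n k a b (x s)) + (\<Sum>d. (c d)\<^sup>2 * 2 ^ d) * real k)"
    unfolding F_def inner_layer_def
    by (intro sums_add sums_diff sums_mult sums_sum sums_mult2 summable_sums c(1)
        kernel_sums c(2) abs_inner_prod_le_1) (use a x in auto)
  fix d
  \<comment> \<open>After division by \<open>2 ^ d\<close> this scaling leaves
    \<open>c d * b i\<close> in the cross term, as in the power series of the inner layer, and turns
    the square into the weight \<open>(c d)\<^sup>2 * 2 ^ d\<close>.\<close>
  define \<beta> where "\<beta> i = 2 ^ d * c d * b i" for i
  have "(\<Sum>i<k. \<Sum>j<k. b i * b j * inner_prod n (a i) (a j) ^ d) \<le> (\<Sum>i<k. \<Sum>j<k. \<bar>b i\<bar> * \<bar>b j\<bar>)"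
  proof (intro sum_mono)
    fix i j assume "i \<in> {..<k}" "j \<in> {..<k}"
    hence "\<bar>inner_prod n (a i) (a j) ^ d\<bar> \<le> 1"
      using abs_inner_prod_le_1[of "a i" n "a j"] a by (simp add: power_abs power_le_one)
    hence "\<bar>b i * b j\<bar> * \<bar>inner_prod n (a i) (a j) ^ d\<bar> \<le> \<bar>b i * b j\<bar>"
      by (intro mult_left_le) auto
    hence "\<bar>b i * b j * inner_prod n (a i) (a j) ^ d\<bar> \<le> \<bar>b i\<bar> * \<bar>b j\<bar>"
      by (simp add: abs_mult)
    thus "b i * b j * inner_prod n (a i) (a j) ^ d \<le> \<bar>b i\<bar> * \<bar>b j\<bar>" by linarith
  qed
  also have "\<dots> = (\<Sum>j<k. \<bar>b j\<bar>)\<^sup>2" by (simp add: power2_eq_square sum_product)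
  also have "\<dots> \<le> k" by (rule sum_abs_le_sqrt_card[OF b])
  finally have k: "(\<Sum>i<k. \<Sum>j<k. b i * b j * inner_prod n (a i) (a j) ^ d) \<le> k" .
  have "0 \<le> ((\<Sum>s<T. \<Sum>t<T. \<alpha> s * \<alpha> t * inner_prod n (x s) (x t) ^ d)
            - 2 * (\<Sum>s<T. \<Sum>j<k. \<alpha> s * \<beta> j * inner_prod n (a j) (x s) ^ d)
            + (\<Sum>i<k. \<Sum>j<k. \<beta> i * \<beta> j * inner_prod n (a i) (a j) ^ d)) / 2 ^ d"
    using inner_power_psd[of "{..<T}" "{..<k}"] by (intro divide_nonneg_nonneg) auto
  also have "\<dots> = (\<Sum>s<T. \<Sum>t<T. \<alpha> s * \<alpha> t * (inner_prod n (x s) (x t) ^ d / 2 ^ d))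
     - 2 * (\<Sum>s<T. \<alpha> s * (\<Sum>i<k. b i * (c d * inner_prod n (a i) (x s) ^ d)))
     + ((c d)\<^sup>2 * 2 ^ d) * (\<Sum>i<k. \<Sum>j<k. b i * b j * inner_prod n (a i) (a j) ^ d)"
  proof -
    have "(\<Sum>s<T. \<Sum>t<T. \<alpha> s * \<alpha> t * inner_prod n (x s) (x t) ^ d) / 2 ^ d
      = (\<Sum>s<T. \<Sum>t<T. \<alpha> s * \<alpha> t * (inner_prod n (x s) (x t) ^ d / 2 ^ d))"
      by (simp add: sum_divide_distrib)
    moreover have "(\<Sum>s<T. \<Sum>j<k. \<alpha> s * \<beta> j * inner_prod n (a j) (x s) ^ d) / 2 ^ d
      = (\<Sum>s<T. \<alpha> s * (\<Sum>i<k. b i * (c d * inner_prod n (a i) (x s) ^ d)))"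
      unfolding sum_divide_distrib sum_distrib_left
      by (intro sum.cong refl) (simp add: \<beta>_def)
    moreover have "(\<Sum>i<k. \<Sum>j<k. \<beta> i * \<beta> j * inner_prod n (a i) (a j) ^ d) / 2 ^ d
      = (c d)\<^sup>2 * 2 ^ d * (\<Sum>i<k. \<Sum>j<k. b i * b j * inner_prod n (a i) (a j) ^ d)"
      unfolding sum_divide_distrib sum_distrib_left
      by (intro sum.cong refl) (simp add: \<beta>_def power2_eq_square)
    ultimately show ?thesis by (simp add: add_divide_distrib diff_divide_distrib)
  qed
  also have "\<dots> \<le> F d"
    unfolding F_def using k by (intro add_left_mono mult_left_mono) auto
  finally show "0 \<le> F d" .
qed

lemma activation_gap:
  assumes "activation L u"
  shows "(u p - u q)\<^sup>2 \<le> L * ((u p - u q) * (p - q))"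
proof -
  have lip: "\<bar>u p - u q\<bar> \<le> L * \<bar>p - q\<bar>"
    using assms by (auto simp: activation_def dist_real_def dest: lipschitz_onD)
  have mono: "p \<le> q \<Longrightarrow> u p \<le> u q" "q \<le> p \<Longrightarrow> u q \<le> u p"
    using assms by (auto simp: activation_def mono_def)
  have "(u p - u q)\<^sup>2 = \<bar>u p - u q\<bar> * \<bar>u p - u q\<bar>" by (simp add: power2_eq_square)
  also have "\<dots> \<le> \<bar>u p - u q\<bar> * (L * \<bar>p - q\<bar>)" using lip by (intro mult_left_mono) auto
  also have "\<dots> = L * ((u p - u q) * (p - q))"
    using mono by (cases "p \<le> q") (auto simp: abs_if algebra_simps)
  finally show ?thesis .
qed

text \<open>On \<open>[-1, 1]\<close> the sigmoid is at most 3/4 because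
  \<open>exp 1 \<le> 3\<close>, and the weights have absolute sum at most \<open>sqrt k\<close>. The
  resulting factor 9/16 is the threshold in \<open>step_size\<close>.\<close>

lemma inner_layer_bound:
  assumes b: "b \<in> unit_sphere k" and a: "\<And>i. i < k \<Longrightarrow> a i \<in> unit_sphere n"
    and x: "x \<in> unit_sphere n"
  shows "16 * (inner_layer n k a b x)\<^sup>2 \<le> 9 * real k"
proof -
  have sig: "0 \<le> sigmoid z \<and> sigmoid z \<le> 3 / 4" if "\<bar>z\<bar> \<le> 1" for z
  proof -
    have "1 \<le> exp (- z) * exp z" by (simp flip: exp_add)
    moreover have "exp z \<le> 3"
      using that order_trans[OF _ exp_le, of "exp z"] by simp
    hence "exp (- z) * exp z \<le> exp (- z) * 3" by (intro mult_left_mono) auto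
    ultimately have "1 \<le> exp (- z) * 3" by linarith
    thus ?thesis using exp_gt_zero[of "- z"] by (simp add: sigmoid_def field_simps)
  qed
  have "\<bar>inner_layer n k a b x\<bar> \<le> (\<Sum>i<k. \<bar>b i * sigmoid (inner_prod n (a i) x)\<bar>)"
    unfolding inner_layer_def by (rule sum_abs)
  also have "\<dots> \<le> (\<Sum>i<k. \<bar>b i\<bar> * (3 / 4))"
  proof (rule sum_mono)
    fix i assume "i \<in> {..<k}"
    hence "0 \<le> sigmoid (inner_prod n (a i) x) \<and> sigmoid (inner_prod n (a i) x) \<le> 3 / 4"
      using sig[OF abs_inner_prod_le_1] a x by blast
    thus "\<bar>b i * sigmoid (inner_prod n (a i) x)\<bar> \<le> \<bar>b i\<bar> * (3 / 4)"
      unfolding abs_mult by (intro mult_left_mono) auto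
  qed
  also have "\<dots> = 3 / 4 * (\<Sum>i<k. \<bar>b i\<bar>)" by (simp add: sum_distrib_left mult_ac)
  finally have "\<bar>inner_layer n k a b x\<bar>\<^sup>2 \<le> (3 / 4 * (\<Sum>i<k. \<bar>b i\<bar>))\<^sup>2"
    by (rule power_mono) simp
  also have "\<dots> = 9 / 16 * (\<Sum>i<k. \<bar>b i\<bar>)\<^sup>2"
    by (simp add: power_mult_distrib power_divide)
  finally show ?thesis using sum_abs_le_sqrt_card[OF b] by simp
qed

section \<open>The algorithm\<close>

text \<open>Labels are clipped to \<open>[0, 1]\<close> so that predictors are bounded for every sample, not only
  almost surely.\<close>

primrec predictor :: "(real \<Rightarrow> real) \<Rightarrow> nat \<Rightarrow> real \<Rightarrow> sample \<Rightarrow> nat \<Rightarrow> vec \<Rightarrow> real" where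
  "predictor u n lam S 0 = (\<lambda>x. 0)"
| "predictor u n lam S (Suc t) = (\<lambda>x. predictor u n lam S t x +
     lam * (max 0 (min 1 (snd (S t))) - u (predictor u n lam S t (fst (S t)))) * kernel n (fst (S t)) x)"

text \<open>The index \<open>i\<close> runs through all samples, across blocks. The value is the
  predictor just before sample \<open>i\<close> is used, hence zero at the start of every
  block.\<close>

definition iterate :: "(real \<Rightarrow> real) \<Rightarrow> nat \<Rightarrow> real \<Rightarrow> nat \<Rightarrow> sample \<Rightarrow> nat \<Rightarrow> vec \<Rightarrow> real" where
  "iterate u n lam T S i = predictor u n lam (\<lambda>s. S (i div T * T + s)) (i mod T)"

definition coefficient :: "(real \<Rightarrow> real) \<Rightarrow> nat \<Rightarrow> real \<Rightarrow> nat \<Rightarrow> sample \<Rightarrow> nat \<Rightarrow> real" where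
  "coefficient u n lam T S i = lam * (max 0 (min 1 (snd (S i))) - u (iterate u n lam T S i (fst (S i))))"

text \<open>The \<open>m + 1\<close> terms include the iterate that follows the last sample, so the
  denominator is positive even when \<open>m = 0\<close>.\<close>

definition averaged :: "(real \<Rightarrow> real) \<Rightarrow> nat \<Rightarrow> real \<Rightarrow> nat \<Rightarrow> nat \<Rightarrow> sample \<Rightarrow> vec \<Rightarrow> real" where
  "averaged u n lam T m S x = (\<Sum>i\<le>m. u (iterate u n lam T S i x)) / (real m + 1)"

text \<open>The programs carry this real number rather than its rounding, since they cannot turn
  reals into naturals. The factor \<open>A\<close> is fixed later from the norm of the
  sigmoid.\<close>

definition block_bound :: "nat \<Rightarrow> nat \<Rightarrow> real \<Rightarrow> real \<Rightarrow> real" where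
  "block_bound A k L \<epsilon> = real A * real k * L * L / (\<epsilon> * \<epsilon>)"

definition block_length :: "real \<Rightarrow> nat" where
  "block_length \<beta> = max 1 (nat \<lceil>\<beta>\<rceil>)"

text \<open>The value \<open>\<epsilon> / (4 * L)\<close> makes the term \<open>L * lam\<close> of
  the error bound equal to \<open>\<epsilon> / 4\<close>. For positive \<epsilon> the test fails
  when \<open>L = 0\<close>, so the division is safe.\<close>

definition step_size :: "nat \<Rightarrow> real \<Rightarrow> real \<Rightarrow> real" where
  "step_size k L \<epsilon> = (if 16 * \<epsilon> < 9 * L * L * real k then \<epsilon> / (4 * L) else 0)"

text \<open>Lets a program detect the end of a block by comparing its counter with the real bound,
  without computing a ceiling. The counter must be positive because lengths are at least 1 even for
  a bound below 0.\<close>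

lemma less_block_length_iff: "0 < c \<Longrightarrow> real c < \<beta> \<longleftrightarrow> c < block_length \<beta>"
  unfolding block_length_def by (auto simp: less_max_iff_disj zless_nat_eq_int_zless less_ceiling_iff)

lemma iterate_0: "iterate u n lam T S 0 x = 0"
  by (simp add: iterate_def)

text \<open>The recurrence that the loop of \<open>kernel_pass\<close> executes: a reset at block
  ends replaces division with remainder.\<close>

lemma iterate_Suc:
  assumes "0 < T"
  shows "iterate u n lam T S (Suc i) x = (if Suc (i mod T) < T
     then iterate u n lam T S i x + coefficient u n lam T S i * kernel n (fst (S i)) x else 0)"
proof (cases "Suc (i mod T) < T")
  case True
  hence "Suc i mod T = Suc (i mod T)" by (simp add: mod_Suc)
  moreover from this have "Suc i div T = i div T"
    using assms by (simp add: div_Suc)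
  ultimately show ?thesis using True
    by (simp add: iterate_def coefficient_def)
next
  case False
  hence "Suc (i mod T) = T" using mod_less_divisor[OF assms, of i] by linarith
  hence "Suc i mod T = 0" by (simp add: mod_Suc)
  thus ?thesis using False by (simp add: iterate_def)
qed

section \<open>Programs\<close>

text \<open>A total-correctness triple with a time budget. The budget is an upper bound, so branches
  of different cost and loop bodies can share one.\<close>

definition runs :: "(real \<Rightarrow> real) \<Rightarrow> com \<Rightarrow> nat \<Rightarrow> state \<Rightarrow> (state \<Rightarrow> bool) \<Rightarrow> bool" where
  "runs u c T s Q \<longleftrightarrow> (\<exists>t s'. exec u c s t s' \<and> t \<le> T \<and> Q s')"

lemma runs_Skip: "1 \<le> T \<Longrightarrow> Q s \<Longrightarrow> runs u Skip T s Q"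
  unfolding runs_def by (meson exec.Skip)

lemma runs_NAssign: "1 \<le> T \<Longrightarrow> Q (s\<lparr>nats := (nats s)(v := nval e s)\<rparr>) \<Longrightarrow> runs u (NAssign v e) T s Q"
  unfolding runs_def using exec.NAssign by blast

lemma runs_RAssign: "1 \<le> T \<Longrightarrow> Q (s\<lparr>reals := (reals s)(v := rval u e s)\<rparr>) \<Longrightarrow> runs u (RAssign v e) T s Q"
  unfolding runs_def using exec.RAssign by blast

lemma runs_CellAssign:
  "1 \<le> T \<Longrightarrow> Q (s\<lparr>arrays := (arrays s)(v := (arrays s v)(nval i s := rval u e s))\<rparr>) \<Longrightarrow>
   runs u (CellAssign v i e) T s Q"
  unfolding runs_def using exec.CellAssign by blast

lemma runs_Seq:
  assumes "runs u c \<tau> s P" "\<tau> \<le> T" "\<And>s'. P s' \<Longrightarrow> runs u d (T - \<tau>) s' Q"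
  shows "runs u (Seq c d) T s Q"
proof -
  obtain t s' where 1: "exec u c s t s'" "t \<le> \<tau>" "P s'"
    using assms(1) by (auto simp: runs_def)
  obtain t' s'' where 2: "exec u d s' t' s''" "t' \<le> T - \<tau>" "Q s''"
    using assms(3)[OF 1(3)] by (auto simp: runs_def)
  have "exec u (Seq c d) s (t + t') s''" by (rule exec.Seq[OF 1(1) 2(1)])
  thus ?thesis using 1 2 assms(2) unfolding runs_def by (intro exI[of _ "t + t'"] exI[of _ s'']) auto
qed

text \<open>This rule and the next two execute leading assignments symbolically, with the explicit
  successor state in place of an intermediate assertion.\<close>

lemma runs_Seq_NAssign:
  assumes "1 \<le> T" "runs u d (T - 1) (s\<lparr>nats := (nats s)(v := nval e s)\<rparr>) Q"
  shows "runs u (Seq (NAssign v e) d) T s Q"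
  using assms by (intro runs_Seq[where \<tau> = 1 and P = "\<lambda>s'. s' = s\<lparr>nats := (nats s)(v := nval e s)\<rparr>"] runs_NAssign) auto

lemma runs_Seq_RAssign:
  assumes "1 \<le> T" "runs u d (T - 1) (s\<lparr>reals := (reals s)(v := rval u e s)\<rparr>) Q"
  shows "runs u (Seq (RAssign v e) d) T s Q"
  using assms by (intro runs_Seq[where \<tau> = 1 and P = "\<lambda>s'. s' = s\<lparr>reals := (reals s)(v := rval u e s)\<rparr>"] runs_RAssign) auto

lemma runs_Seq_CellAssign:
  assumes "1 \<le> T" "runs u d (T - 1) (s\<lparr>arrays := (arrays s)(v := (arrays s v)(nval i s := rval u e s))\<rparr>) Q"
  shows "runs u (Seq (CellAssign v i e) d) T s Q"
  using assms by (intro runs_Seq[where \<tau> = 1 and P = "\<lambda>s'. s' = s\<lparr>arrays := (arrays s)(v := (arrays s v)(nval i s := rval u e s))\<rparr>"] runs_CellAssign) auto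

lemma runs_Cond:
  assumes "1 \<le> T" "bval u g s \<Longrightarrow> runs u c (T - 1) s Q" "\<not> bval u g s \<Longrightarrow> runs u d (T - 1) s Q"
  shows "runs u (Cond g c d) T s Q"
proof (cases "bval u g s")
  case True
  then obtain t s' where "exec u c s t s'" "t \<le> T - 1" "Q s'" using assms by (auto simp: runs_def)
  with exec.CondTrue[OF True this(1), of d] assms(1) show ?thesis
    unfolding runs_def by (intro exI[of _ "t + 1"] exI[of _ s']) auto
next
  case False
  then obtain t s' where "exec u d s t s'" "t \<le> T - 1" "Q s'" using assms by (auto simp: runs_def)
  with exec.CondFalse[OF False this(1), of c] assms(1) show ?thesis
    unfolding runs_def by (intro exI[of _ "t + 1"] exI[of _ s']) auto
qed

text \<open>The invariant is indexed by the number of completed iterations, and induction runs on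
  \<open>N - i\<close>. Each iteration pays \<open>B\<close> for the body and 1 for its test; the
  last summand is the failing test.\<close>

lemma runs_While:
  assumes step: "\<And>i s. i < N \<Longrightarrow> I i s \<Longrightarrow> bval u g s \<and> runs u c B s (I (Suc i))"
    and stop: "\<And>s. I N s \<Longrightarrow> \<not> bval u g s \<and> Q s"
    and init: "I 0 s" and time: "N * (B + 1) + 1 \<le> T"
  shows "runs u (While g c) T s Q"
proof -
  have "i \<le> N \<Longrightarrow> I i s \<Longrightarrow> \<exists>t s'. exec u (While g c) s t s' \<and> t \<le> (N - i) * (B + 1) + 1 \<and> Q s'" for i s
  proof (induction "N - i" arbitrary: i s)
    case 0
    hence "i = N" by simp
    with stop 0 exec.WhileFalse[of u g s c] show ?case by fastforce
  next
    case (Suc d)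
    hence i: "i < N" by simp
    then obtain t s' where 1: "exec u c s t s'" "t \<le> B" "I (Suc i) s'" and g: "bval u g s"
      using step[OF i Suc.prems(2)] by (auto simp: runs_def)
    have d: "d = N - Suc i" using Suc.hyps(2) by simp
    obtain t' s'' where 2: "exec u (While g c) s' t' s''" "t' \<le> (N - Suc i) * (B + 1) + 1" "Q s''"
      using Suc.hyps(1)[OF d Suc_leI[OF i] 1(3)] by blast
    have "N - i = Suc (N - Suc i)" using i by simp
    with 1 2 exec.WhileTrue[OF g 1(1) 2(1)] show ?case
      by (intro exI[of _ "t + t' + 1"] exI[of _ s'']) auto
  qed
  from this[of 0 s] init time show ?thesis unfolding runs_def by (fastforce intro: le_trans)
qed

lemmas runs_step = runs_Seq_NAssign runs_Seq_RAssign runs_Seq_CellAssign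

section \<open>The loops from which learner and evaluator are built\<close>

fun block :: "com list \<Rightarrow> com" where
  "block [] = Skip"
| "block [c] = c"
| "block (c # d # cs) = Seq c (block (d # cs))"

definition dot_loop :: com where
  "dot_loop = block
    [NAssign ''j'' (NConst 0),
     RAssign ''dot'' (RConst 0),
     While (NLess (NVar ''j'') (NVar ''n'')) (block
       [RAssign ''dot'' (RPlus (RVar ''dot'') (RTimes
          (RCell ''rep'' (NPlus (NPlus (NVar ''pos'') (NConst 1)) (NVar ''j'')))
          (RCell ''x'' (NPlus (NVar ''off'') (NVar ''j''))))),
        NAssign ''j'' (NPlus (NVar ''j'') (NConst 1))])]"

text \<open>The invariant holds the partial sum over the first \<open>i\<close> coordinates; the
  offset 1 skips the coefficient at the head of a row. The postcondition is arbitrary and its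
  premise lists the result and everything left unchanged, so the rule fits under any assertion of
  the caller.\<close>

lemma runs_dot_loop:
  assumes "\<And>s'. reals s' ''dot'' = (\<Sum>j<nats s ''n''. arrays s ''rep'' (nats s ''pos'' + 1 + j) * arrays s ''x'' (nats s ''off'' + j)) \<Longrightarrow>
      arrays s' = arrays s \<Longrightarrow> (\<And>v. v \<noteq> ''j'' \<Longrightarrow> nats s' v = nats s v) \<Longrightarrow>
      (\<And>v. v \<noteq> ''dot'' \<Longrightarrow> reals s' v = reals s v) \<Longrightarrow> Q s'"
    and T: "3 * nats s ''n'' + 3 \<le> T"
  shows "runs u dot_loop T s Q"
  unfolding dot_loop_def block.simps
  apply (rule runs_step, use T in simp)+
  apply (rule runs_While[where N = "nats s ''n''" and B = 2 and
    I = "\<lambda>i s'. nats s' ''j'' = i \<and> reals s' ''dot'' = (\<Sum>j<i. arrays s ''rep'' (nats s ''pos'' + 1 + j) * arrays s ''x'' (nats s ''off'' + j)) \<and>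
      arrays s' = arrays s \<and> (\<forall>v. v \<noteq> ''j'' \<longrightarrow> nats s' v = nats s v) \<and>
      (\<forall>v. v \<noteq> ''dot'' \<longrightarrow> reals s' v = reals s v)"])
  subgoal by (auto intro!: runs_step runs_NAssign)
  subgoal using assms(1) by auto
  subgoal by simp
  subgoal using T by simp
  done

definition copy_loop :: com where
  "copy_loop = block
    [NAssign ''j'' (NConst 0),
     While (NLess (NVar ''j'') (NVar ''n'')) (block
       [CellAssign ''rep'' (NPlus (NPlus (NVar ''lim'') (NConst 1)) (NVar ''j''))
          (RCell ''x'' (NPlus (NVar ''off'') (NVar ''j''))),
        NAssign ''j'' (NPlus (NVar ''j'') (NConst 1))])]"

lemma runs_copy_loop:
  assumes "\<And>s'. reals s' = reals s \<Longrightarrow> (\<And>v. v \<noteq> ''rep'' \<Longrightarrow> arrays s' v = arrays s v) \<Longrightarrow>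
      (\<And>v. v \<noteq> ''j'' \<Longrightarrow> nats s' v = nats s v) \<Longrightarrow>
      (\<And>j. j < nats s ''n'' \<Longrightarrow> arrays s' ''rep'' (nats s ''lim'' + 1 + j) = arrays s ''x'' (nats s ''off'' + j)) \<Longrightarrow>
      (\<And>a. a \<le> nats s ''lim'' \<Longrightarrow> arrays s' ''rep'' a = arrays s ''rep'' a) \<Longrightarrow> Q s'"
    and T: "3 * nats s ''n'' + 2 \<le> T"
  shows "runs u copy_loop T s Q"
  unfolding copy_loop_def block.simps
  apply (rule runs_step, use T in simp)+
  apply (rule runs_While[where N = "nats s ''n''" and B = 2 and
    I = "\<lambda>i s'. nats s' ''j'' = i \<and> reals s' = reals s \<and> (\<forall>v. v \<noteq> ''rep'' \<longrightarrow> arrays s' v = arrays s v) \<and>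
      (\<forall>v. v \<noteq> ''j'' \<longrightarrow> nats s' v = nats s v) \<and>
      (\<forall>j<i. arrays s' ''rep'' (nats s ''lim'' + 1 + j) = arrays s ''x'' (nats s ''off'' + j)) \<and>
      (\<forall>a. a \<le> nats s ''lim'' \<longrightarrow> arrays s' ''rep'' a = arrays s ''rep'' a)"])
  subgoal by (auto intro!: runs_step runs_NAssign simp: less_Suc_eq)
  subgoal using assms(1) by auto
  subgoal by simp
  subgoal using T by simp
  done

text \<open>One sweep over the stored rows evaluates all iterates at the point at
  \<open>off\<close>: when row \<open>i\<close> is reached, \<open>p\<close> is the value of iterate
  \<open>i\<close>, and its image under the oracle goes into \<open>sum\<close>. The learner needs
  the final \<open>p\<close>, the evaluator also \<open>sum\<close>. The quotient is the kernel
  without clipping, which is the same on the sphere.\<close>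

definition kernel_pass :: com where
  "kernel_pass = block
    [NAssign ''pos'' (NConst 0),
     NAssign ''cnt'' (NConst 0),
     NAssign ''rows'' (NConst 0),
     RAssign ''p'' (RConst 0),
     RAssign ''sum'' (RConst 0),
     While (NLess (NVar ''pos'') (NVar ''lim'')) (block
       [RAssign ''sum'' (RPlus (RVar ''sum'') (ROracle (RVar ''p''))),
        dot_loop,
        RAssign ''p'' (RPlus (RVar ''p'') (RTimes (RCell ''rep'' (NVar ''pos''))
          (RDivide (RConst 2) (RMinus (RConst 2) (RVar ''dot''))))),
        NAssign ''pos'' (NPlus (NVar ''pos'') (NPlus (NVar ''n'') (NConst 1))),
        NAssign ''rows'' (NPlus (NVar ''rows'') (NConst 1)),
        NAssign ''cnt'' (NPlus (NVar ''cnt'') (NConst 1)),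
        Cond (RLess (ROfNat (NVar ''cnt'')) (RVar ''beta'')) Skip (block
          [NAssign ''cnt'' (NConst 0),
           RAssign ''p'' (RConst 0)])])]"

text \<open>Layout of the output: row \<open>i\<close> occupies \<open>n + 1\<close> cells, the coefficient of sample \<open>i\<close> followed
  by its point. The block bound is appended behind the last row, where the evaluator, which does
  not receive \<open>k\<close>, \<open>L\<close> and \<open>\<epsilon>\<close>, finds it.\<close>

definition stores_rows :: "(nat \<Rightarrow> real) \<Rightarrow> nat \<Rightarrow> nat \<Rightarrow> (nat \<Rightarrow> real) \<Rightarrow> (nat \<Rightarrow> vec) \<Rightarrow> bool" where
  "stores_rows rep n r \<alpha> X \<longleftrightarrow>
     (\<forall>i<r. rep (i * (n + 1)) = \<alpha> i \<and> (\<forall>j<n. rep (i * (n + 1) + 1 + j) = X i j))"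

lemma runs_kernel_pass:
  assumes lim: "nats s ''lim'' = r * (n + 1)" and n: "nats s ''n'' = n"
    and beta: "T = block_length (reals s ''beta'')"
    and rows: "stores_rows (arrays s ''rep'') n r (coefficient u n lam T S) (\<lambda>i. fst (S i))"
    and S: "\<And>i. i < r \<Longrightarrow> fst (S i) \<in> unit_sphere n"
    and x: "x \<in> unit_sphere n" "\<And>j. j < n \<Longrightarrow> arrays s ''x'' (nats s ''off'' + j) = x j"
    and Q: "\<And>s'. reals s' ''p'' = iterate u n lam T S r x \<Longrightarrow>
      reals s' ''sum'' = (\<Sum>i<r. u (iterate u n lam T S i x)) \<Longrightarrow> nats s' ''rows'' = r \<Longrightarrow>
      arrays s' = arrays s \<Longrightarrow> (\<And>v. v \<notin> {''j'', ''pos'', ''cnt'', ''rows''} \<Longrightarrow> nats s' v = nats s v) \<Longrightarrow>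
      (\<And>v. v \<notin> {''p'', ''sum'', ''dot''} \<Longrightarrow> reals s' v = reals s v) \<Longrightarrow> Q s'"
    and time: "r * (3 * n + 12) + 6 \<le> B"
  shows "runs u kernel_pass B s Q"
proof -
  have T: "0 < T" by (simp add: beta block_length_def)
  define I where "I i s' \<longleftrightarrow> reals s' ''p'' = iterate u n lam T S i x \<and>
      reals s' ''sum'' = (\<Sum>i<i. u (iterate u n lam T S i x)) \<and> nats s' ''rows'' = i \<and>
      nats s' ''pos'' = i * (n + 1) \<and> nats s' ''cnt'' = i mod T \<and>
      arrays s' = arrays s \<and> (\<forall>v. v \<notin> {''j'', ''pos'', ''cnt'', ''rows''} \<longrightarrow> nats s' v = nats s v) \<and>
      (\<forall>v. v \<notin> {''p'', ''sum'', ''dot''} \<longrightarrow> reals s' v = reals s v)" for i and s' :: state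
  show ?thesis
    unfolding kernel_pass_def block.simps
    apply (rule runs_step, use time in simp)+
    \<comment> \<open>The body costs \<open>3 * n + 3\<close> for the inner product, five
      assignments, and at most three steps for the conditional with its reset. Outside the loop body
      there are five initialisations and the failing test.\<close>
    apply (rule runs_While[where N = r and B = "3 * n + 11" and I = I])
    subgoal premises prems for i s'
    proof (intro conjI)
      note I = prems(2)[unfolded I_def]
      have "i * (n + 1) < r * (n + 1)" using prems(1) by (intro mult_strict_right_mono) auto
      thus "bval u (NLess (NVar ''pos'') (NVar ''lim'')) s'" using I lim by simp
      have dot: "(\<Sum>j<n. arrays s ''rep'' (i * (n + 1) + 1 + j) * arrays s ''x'' (nats s ''off'' + j))
        = inner_prod n (fst (S i)) x"
        using rows prems(1) x(2) unfolding inner_prod_def by (intro sum.cong) (auto simp: stores_rows_def)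
      have al: "arrays s ''rep'' (i * (n + 1)) = coefficient u n lam T S i"
        using rows prems(1) by (auto simp: stores_rows_def)
      have K: "2 / (2 - inner_prod n (fst (S i)) x) = kernel n (fst (S i)) x"
        using kernel_sphere S x(1) prems(1) by simp
      \<comment> \<open>The counter is incremented before it is tested, so it is positive
        here.\<close>
      have cnt: "real (Suc (i mod T)) < reals s ''beta'' \<longleftrightarrow> Suc (i mod T) < T"
        unfolding beta by (rule less_block_length_iff) simp
      have modS: "Suc i mod T = (if Suc (i mod T) < T then Suc (i mod T) else 0)"
        using mod_less_divisor[OF T, of i] by (auto simp: mod_Suc)
      show "runs u (Seq (RAssign ''sum'' (RPlus (RVar ''sum'') (ROracle (RVar ''p''))))
        (Seq dot_loop (Seq (RAssign ''p'' (RPlus (RVar ''p'') (RTimes (RCell ''rep'' (NVar ''pos''))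
          (RDivide (RConst 2) (RMinus (RConst 2) (RVar ''dot''))))))
        (Seq (NAssign ''pos'' (NPlus (NVar ''pos'') (NPlus (NVar ''n'') (NConst 1))))
        (Seq (NAssign ''rows'' (NPlus (NVar ''rows'') (NConst 1)))
        (Seq (NAssign ''cnt'' (NPlus (NVar ''cnt'') (NConst 1)))
        (Cond (RLess (ROfNat (NVar ''cnt'')) (RVar ''beta'')) Skip (Seq
          (NAssign ''cnt'' (NConst 0)) (RAssign ''p'' (RConst 0))))))))))
          (3 * n + 11) s' (I (Suc i))"
        apply (rule runs_step, simp)
        apply (rule runs_Seq[where \<tau> = "3 * n + 3"])
          apply (rule runs_dot_loop[where Q = "\<lambda>s''. reals s'' ''dot'' = inner_prod n (fst (S i)) x \<and>
            reals s'' ''p'' = iterate u n lam T S i x \<and>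
            reals s'' ''sum'' = (\<Sum>i<Suc i. u (iterate u n lam T S i x)) \<and> nats s'' ''rows'' = i \<and>
            nats s'' ''pos'' = i * (n + 1) \<and> nats s'' ''cnt'' = i mod T \<and>
            arrays s'' = arrays s \<and> (\<forall>v. v \<notin> {''j'', ''pos'', ''cnt'', ''rows''} \<longrightarrow> nats s'' v = nats s v) \<and>
            (\<forall>v. v \<notin> {''p'', ''sum'', ''dot''} \<longrightarrow> reals s'' v = reals s v)"])
           apply (use I n dot in simp)
          apply (use I n in simp)
         apply simp
        apply (rule runs_step, simp)+
        apply (rule runs_Cond, simp)
         apply (rule runs_Skip, simp)
         apply (use cnt al in \<open>simp add: I_def iterate_Suc[OF T] K modS n\<close>)
        apply (rule runs_step, simp)
        apply (rule runs_RAssign, simp)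
        apply (use cnt al in \<open>simp add: I_def iterate_Suc[OF T] K modS n\<close>)
        done
    qed
    subgoal for s' using Q[of s'] lim by (auto simp: I_def)
    subgoal by (simp add: I_def iterate_0)
    subgoal using time by (simp add: algebra_simps)
    done
qed

section \<open>The two programs, their correctness and running time\<close>

definition learner :: "nat \<Rightarrow> com" where
  "learner A = block
    [RAssign ''beta'' (RDivide (RTimes (RTimes (RTimes (RConst (int A)) (ROfNat (NVar ''k''))) (RVar ''L'')) (RVar ''L''))
       (RTimes (RVar ''eps'') (RVar ''eps''))),
     Cond (RLess (RTimes (RConst 16) (RVar ''eps''))
         (RTimes (RTimes (RTimes (RConst 9) (RVar ''L'')) (RVar ''L'')) (ROfNat (NVar ''k''))))
       (RAssign ''lam'' (RDivide (RVar ''eps'') (RTimes (RConst 4) (RVar ''L''))))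
       (RAssign ''lam'' (RConst 0)),
     While (NLess (NVar ''i'') (NVar ''m'')) (block
       [kernel_pass,
        CellAssign ''rep'' (NVar ''lim'') (RTimes (RVar ''lam'')
          (RMinus (RCell ''y'' (NVar ''i'')) (ROracle (RVar ''p'')))),
        copy_loop,
        NAssign ''lim'' (NPlus (NVar ''lim'') (NPlus (NVar ''n'') (NConst 1))),
        NAssign ''off'' (NPlus (NVar ''off'') (NVar ''n'')),
        NAssign ''i'' (NPlus (NVar ''i'') (NConst 1))]),
     CellAssign ''rep'' (NVar ''lim'') (RVar ''beta''),
     NAssign ''len'' (NPlus (NVar ''lim'') (NConst 1))]"

text \<open>The cell behind the last row holds the block bound, so \<open>len - 1\<close> is both
  its index and the end of the rows. The register \<open>off\<close> is initially 0, where the query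
  point starts. The oracle value of the final \<open>p\<close> is the extra summand of the
  average.\<close>

definition evaluator :: com where
  "evaluator = block
    [NAssign ''lim'' (NMinus (NVar ''len'') (NConst 1)),
     RAssign ''beta'' (RCell ''rep'' (NVar ''lim'')),
     kernel_pass,
     RAssign ''out'' (RDivide (RPlus (RVar ''sum'') (ROracle (RVar ''p'')))
       (ROfNat (NPlus (NVar ''rows'') (NConst 1))))]"

lemma row_index_less:
  fixes s i n j :: nat
  assumes "s < i" "j < n"
  shows "s * (n + 1) + 1 + j < i * (n + 1)"
proof -
  have "Suc s * (n + 1) \<le> i * (n + 1)" using assms by (intro mult_right_mono) auto
  thus ?thesis using assms by simp
qed

text \<open>Iterate \<open>i\<close> depends only on samples before \<open>i\<close>, whose rows are
  already stored when sample \<open>i\<close> is processed. So one kernel pass at its point yields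
  the prediction from which the new coefficient is formed. The registers \<open>i\<close>,
  \<open>lim\<close> and \<open>off\<close> start at 0, as the invariant \<open>J 0\<close>
  requires.\<close>

lemma runs_learner:
  assumes S: "\<And>i. i < m \<Longrightarrow> S i \<in> unit_sphere n \<times> {0..1}" and n: "1 \<le> n"
    and T: "T = block_length (block_bound A k L \<epsilon>)" and lam: "lam = step_size k L \<epsilon>"
    and time: "m * (m * (3 * n + 12) + 3 * n + 13) + 6 \<le> B"
  shows "runs u (learner A) B (learner_input n k L \<epsilon> \<delta> m S)
    (\<lambda>s. nats s ''len'' = m * (n + 1) + 1 \<and> arrays s ''rep'' (m * (n + 1)) = block_bound A k L \<epsilon> \<and>
      stores_rows (arrays s ''rep'') n m (coefficient u n lam T S) (\<lambda>i. fst (S i)))"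
proof -
  have fS: "fst (S i) \<in> unit_sphere n" if "i < m" for i using S[OF that] by auto
  let ?s0 = "learner_input n k L \<epsilon> \<delta> m S"
  let ?R = "\<lambda>s r. stores_rows (arrays s ''rep'') n r (coefficient u n lam T S) (\<lambda>i. fst (S i))"
  define J where "J i s \<longleftrightarrow> nats s ''i'' = i \<and> nats s ''lim'' = i * (n + 1) \<and> nats s ''off'' = i * n \<and>
      nats s ''n'' = n \<and> nats s ''m'' = m \<and> reals s ''beta'' = block_bound A k L \<epsilon> \<and>
      reals s ''lam'' = lam \<and> arrays s ''x'' = arrays ?s0 ''x'' \<and> arrays s ''y'' = arrays ?s0 ''y'' \<and> ?R s i"
    for i and s :: state
  have J0: "J 0 (?s0\<lparr>reals := (reals ?s0)(''beta'' := block_bound A k L \<epsilon>, ''lam'' := lam)\<rparr>)"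
    by (simp add: J_def learner_input_def stores_rows_def)
  have step: "bval u (NLess (NVar ''i'') (NVar ''m'')) s \<and> runs u (block
       [kernel_pass,
        CellAssign ''rep'' (NVar ''lim'') (RTimes (RVar ''lam'')
          (RMinus (RCell ''y'' (NVar ''i'')) (ROracle (RVar ''p'')))),
        copy_loop,
        NAssign ''lim'' (NPlus (NVar ''lim'') (NPlus (NVar ''n'') (NConst 1))),
        NAssign ''off'' (NPlus (NVar ''off'') (NVar ''n'')),
        NAssign ''i'' (NPlus (NVar ''i'') (NConst 1))]) (m * (3 * n + 12) + 3 * n + 12) s (J (Suc i))"
    if i: "i < m" and Ji: "J i s" for i s
  proof
    note J = Ji[unfolded J_def]
    show "bval u (NLess (NVar ''i'') (NVar ''m'')) s" using J i by simp
    have Si: "fst (S i) \<in> unit_sphere n" "0 \<le> snd (S i)" "snd (S i) \<le> 1" using S[OF i] by auto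
    have x: "arrays s ''x'' (i * n + j) = fst (S i) j" if "j < n" for j
    proof -
      have "Suc i * n \<le> m * n" using i by (intro mult_right_mono) auto
      hence "i * n + j < m * n" using that by simp
      thus ?thesis using J that by (simp add: learner_input_def)
    qed
    have y: "arrays s ''y'' i = snd (S i)" using J i by (simp add: learner_input_def)
    \<comment> \<open>The program does not clip labels; for labels in \<open>[0, 1]\<close> clipping
      is the identity.\<close>
    have co: "lam * (snd (S i) - u (iterate u n lam T S i (fst (S i)))) = coefficient u n lam T S i"
      using Si by (simp add: coefficient_def)
    have im: "i * (3 * n + 12) + 6 \<le> m * (3 * n + 12) + 6" using i by simp
    have row: "?R s' (Suc i)" if old: "\<And>a. a < i * (n + 1) \<Longrightarrow> arrays s' ''rep'' a = arrays s ''rep'' a"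
      and new: "arrays s' ''rep'' (i * (n + 1)) = coefficient u n lam T S i"
        "\<And>j. j < n \<Longrightarrow> arrays s' ''rep'' (i * (n + 1) + 1 + j) = fst (S i) j" for s'
      unfolding stores_rows_def
    proof (intro allI impI)
      fix l assume "l < Suc i"
      then consider "l < i" | "l = i" by linarith
      then show "arrays s' ''rep'' (l * (n + 1)) = coefficient u n lam T S l \<and>
         (\<forall>j<n. arrays s' ''rep'' (l * (n + 1) + 1 + j) = fst (S l) j)"
      proof cases
        case 1
        have "l * (n + 1) < i * (n + 1)" using 1 by (intro mult_strict_right_mono) auto
        moreover have "l * (n + 1) + 1 + j < i * (n + 1)" if "j < n" for j
          using row_index_less[OF 1 that] .
        ultimately show ?thesis using old J 1 unfolding stores_rows_def by simp
      next
        case 2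
        then show ?thesis using new by simp
      qed
    qed
    show "runs u (block
       [kernel_pass,
        CellAssign ''rep'' (NVar ''lim'') (RTimes (RVar ''lam'')
          (RMinus (RCell ''y'' (NVar ''i'')) (ROracle (RVar ''p'')))),
        copy_loop,
        NAssign ''lim'' (NPlus (NVar ''lim'') (NPlus (NVar ''n'') (NConst 1))),
        NAssign ''off'' (NPlus (NVar ''off'') (NVar ''n'')),
        NAssign ''i'' (NPlus (NVar ''i'') (NConst 1))]) (m * (3 * n + 12) + 3 * n + 12) s (J (Suc i))"
      unfolding block.simps
    proof (rule runs_Seq)
      show "runs u kernel_pass (m * (3 * n + 12) + 6) s (\<lambda>s'. reals s' ''p'' = iterate u n lam T S i (fst (S i)) \<and>
         arrays s' = arrays s \<and> (\<forall>v. v \<notin> {''j'', ''pos'', ''cnt'', ''rows''} \<longrightarrow> nats s' v = nats s v) \<and>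
         (\<forall>v. v \<notin> {''p'', ''sum'', ''dot''} \<longrightarrow> reals s' v = reals s v))"
        by (rule runs_kernel_pass[where r = i and S = S and x = "fst (S i)" and n = n and lam = lam and T = T])
          (use J x Si fS i im T in auto)
      show "m * (3 * n + 12) + 6 \<le> m * (3 * n + 12) + 3 * n + 12" by simp
      fix s' :: state
      assume s': "reals s' ''p'' = iterate u n lam T S i (fst (S i)) \<and>
         arrays s' = arrays s \<and> (\<forall>v. v \<notin> {''j'', ''pos'', ''cnt'', ''rows''} \<longrightarrow> nats s' v = nats s v) \<and>
         (\<forall>v. v \<notin> {''p'', ''sum'', ''dot''} \<longrightarrow> reals s' v = reals s v)"
      let ?s1 = "s'\<lparr>arrays := (arrays s)(''rep'' := (arrays s ''rep'')(i * (n + 1) := coefficient u n lam T S i))\<rparr>"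
      show "runs u (Seq (CellAssign ''rep'' (NVar ''lim'') (RTimes (RVar ''lam'')
          (RMinus (RCell ''y'' (NVar ''i'')) (ROracle (RVar ''p'')))))
        (Seq copy_loop
        (Seq (NAssign ''lim'' (NPlus (NVar ''lim'') (NPlus (NVar ''n'') (NConst 1))))
        (Seq (NAssign ''off'' (NPlus (NVar ''off'') (NVar ''n'')))
        (NAssign ''i'' (NPlus (NVar ''i'') (NConst 1)))))))
        (m * (3 * n + 12) + 3 * n + 12 - (m * (3 * n + 12) + 6)) s' (J (Suc i))"
      proof (rule runs_Seq_CellAssign)
        have "s'\<lparr>arrays := (arrays s')(''rep'' := (arrays s' ''rep'')(nval (NVar ''lim'') s' :=
          rval u (RTimes (RVar ''lam'') (RMinus (RCell ''y'' (NVar ''i'')) (ROracle (RVar ''p'')))) s'))\<rparr> = ?s1"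
          using s' J y co by simp
        moreover have "runs u (Seq copy_loop
          (Seq (NAssign ''lim'' (NPlus (NVar ''lim'') (NPlus (NVar ''n'') (NConst 1))))
          (Seq (NAssign ''off'' (NPlus (NVar ''off'') (NVar ''n'')))
          (NAssign ''i'' (NPlus (NVar ''i'') (NConst 1))))))
          (3 * n + 5) ?s1 (J (Suc i))"
        proof (rule runs_Seq[where P = "\<lambda>s''. ?R s'' (Suc i) \<and> reals s'' = reals s' \<and>
             (\<forall>v. v \<noteq> ''rep'' \<longrightarrow> arrays s'' v = arrays s v) \<and> (\<forall>v. v \<noteq> ''j'' \<longrightarrow> nats s'' v = nats s' v)"])
          show "runs u copy_loop (3 * n + 2) ?s1 (\<lambda>s''. ?R s'' (Suc i) \<and> reals s'' = reals s' \<and>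
             (\<forall>v. v \<noteq> ''rep'' \<longrightarrow> arrays s'' v = arrays s v) \<and> (\<forall>v. v \<noteq> ''j'' \<longrightarrow> nats s'' v = nats s' v))"
          proof (rule runs_copy_loop)
            fix s'' :: state
            assume r: "reals s'' = reals ?s1" "\<And>v. v \<noteq> ''rep'' \<Longrightarrow> arrays s'' v = arrays ?s1 v"
              "\<And>v. v \<noteq> ''j'' \<Longrightarrow> nats s'' v = nats ?s1 v"
              "\<And>j. j < nats ?s1 ''n'' \<Longrightarrow> arrays s'' ''rep'' (nats ?s1 ''lim'' + 1 + j) = arrays ?s1 ''x'' (nats ?s1 ''off'' + j)"
              "\<And>a. a \<le> nats ?s1 ''lim'' \<Longrightarrow> arrays s'' ''rep'' a = arrays ?s1 ''rep'' a"
            have nl: "nats s' ''lim'' = i * (n + 1)" "nats s' ''n'' = n" "nats s' ''off'' = i * n"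
              using s' J by auto
            have "?R s'' (Suc i)"
            proof (rule row)
              show "arrays s'' ''rep'' a = arrays s ''rep'' a" if "a < i * (n + 1)" for a
                using r(5)[of a] that nl by simp
              show "arrays s'' ''rep'' (i * (n + 1)) = coefficient u n lam T S i"
                using r(5)[of "i * (n + 1)"] nl by simp
              show "arrays s'' ''rep'' (i * (n + 1) + 1 + j) = fst (S i) j" if "j < n" for j
                using r(4)[of j] that nl x by simp
            qed
            thus "?R s'' (Suc i) \<and> reals s'' = reals s' \<and>
             (\<forall>v. v \<noteq> ''rep'' \<longrightarrow> arrays s'' v = arrays s v) \<and> (\<forall>v. v \<noteq> ''j'' \<longrightarrow> nats s'' v = nats s' v)"
              using r(1-3) by simp
          qed (use s' J in simp)
        next
          fix s'' :: state
          assume *: "?R s'' (Suc i) \<and> reals s'' = reals s' \<and>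
             (\<forall>v. v \<noteq> ''rep'' \<longrightarrow> arrays s'' v = arrays s v) \<and> (\<forall>v. v \<noteq> ''j'' \<longrightarrow> nats s'' v = nats s' v)"
          show "runs u (Seq (NAssign ''lim'' (NPlus (NVar ''lim'') (NPlus (NVar ''n'') (NConst 1))))
             (Seq (NAssign ''off'' (NPlus (NVar ''off'') (NVar ''n'')))
             (NAssign ''i'' (NPlus (NVar ''i'') (NConst 1))))) (3 * n + 5 - (3 * n + 2)) s'' (J (Suc i))"
            apply (rule runs_step, simp)+
            apply (rule runs_NAssign, simp)
            using * s' J by (simp add: J_def)
        qed simp
        ultimately show "runs u (Seq copy_loop
          (Seq (NAssign ''lim'' (NPlus (NVar ''lim'') (NPlus (NVar ''n'') (NConst 1))))
          (Seq (NAssign ''off'' (NPlus (NVar ''off'') (NVar ''n'')))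
          (NAssign ''i'' (NPlus (NVar ''i'') (NConst 1))))))
          (m * (3 * n + 12) + 3 * n + 12 - (m * (3 * n + 12) + 6) - 1)
          (s'\<lparr>arrays := (arrays s')(''rep'' := (arrays s' ''rep'')(nval (NVar ''lim'') s' :=
          rval u (RTimes (RVar ''lam'') (RMinus (RCell ''y'' (NVar ''i'')) (ROracle (RVar ''p'')))) s'))\<rparr>) (J (Suc i))"
          by (simp add: add.commute[of 5])
      qed simp
    qed
  qed
  show ?thesis
    unfolding learner_def block.simps(3)
    apply (rule runs_step, use time in simp)
    apply (rule runs_Seq[where \<tau> = 2 and P = "J 0"])
      apply (rule runs_Cond, simp)
       apply (rule runs_RAssign, simp)
       apply (use J0 in \<open>simp add: lam step_size_def learner_input_def block_bound_def\<close>)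
      apply (rule runs_RAssign, simp)
      apply (use J0 in \<open>simp add: lam step_size_def learner_input_def block_bound_def\<close>)
     apply (use time in simp)
    \<comment> \<open>An iteration costs at most \<open>m * (3 * n + 12) + 6\<close> for the pass,
      \<open>3 * n + 2\<close> for the copy, four single assignments and the test; the final 1 is
      the failing test.\<close>
    apply (rule runs_Seq[where \<tau> = "m * (m * (3 * n + 12) + 3 * n + 13) + 1" and P = "J m"])
      apply (rule runs_While[where I = J and N = m and B = "m * (3 * n + 12) + 3 * n + 12"])
         apply (rule step[unfolded block.simps(3)], assumption+)
        apply (simp add: J_def)
       apply assumption
      apply simp
     apply (use time in simp)
    apply (rule runs_step, use time in simp)
    unfolding block.simps
    apply (rule runs_NAssign, use time in simp)
    subgoal for s' s''
    proof -
      assume "J m s''"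
      hence J: "nats s'' ''lim'' = m * (n + 1)" "reals s'' ''beta'' = block_bound A k L \<epsilon>" "?R s'' m"
        by (auto simp: J_def)
      \<comment> \<open>The block bound is written to a cell beyond all rows, so none of them is
        overwritten.\<close>
      have "l * (n + 1) \<noteq> m * (n + 1)" if "l < m" for l
        using that by (metis less_irrefl mult_strict_right_mono add_gr_0 zero_less_one)
      moreover have "l * (n + 1) + 1 + j \<noteq> m * (n + 1)" if "l < m" "j < n" for l j
        using row_index_less[OF that] by simp
      ultimately show ?thesis using J unfolding stores_rows_def by simp
    qed
    done
qed

lemma runs_evaluator:
  assumes S: "\<And>i. i < m \<Longrightarrow> S i \<in> unit_sphere n \<times> {0..1}" and x: "x \<in> unit_sphere n"
    and T: "T = block_length \<beta>"
    and w: "length w = m * (n + 1) + 1" "w ! (m * (n + 1)) = \<beta>"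
      "stores_rows (\<lambda>i. w ! i) n m (coefficient u n lam T S) (\<lambda>i. fst (S i))"
    and time: "m * (3 * n + 12) + 9 \<le> B"
  shows "runs u evaluator B (evaluator_input n w x) (\<lambda>s. reals s ''out'' = averaged u n lam T m S x)"
proof -
  have fS: "fst (S i) \<in> unit_sphere n" if "i < m" for i using S[OF that] by auto
  let ?s = "evaluator_input n w x"
  let ?s1 = "?s\<lparr>nats := (nats ?s)(''lim'' := m * (n + 1)), reals := (reals ?s)(''beta'' := \<beta>)\<rparr>"
  have st: "stores_rows (arrays ?s1 ''rep'') n m (coefficient u n lam T S) (\<lambda>i. fst (S i))"
    unfolding stores_rows_def
  proof (intro allI impI)
    fix l assume l: "l < m"
    have "l * (n + 1) < m * (n + 1)" using l by (intro mult_strict_right_mono) auto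
    moreover have "l * (n + 1) + 1 + j < m * (n + 1)" if "j < n" for j
      using row_index_less[OF l that] .
    ultimately show "arrays ?s1 ''rep'' (l * (n + 1)) = coefficient u n lam T S l \<and>
         (\<forall>j<n. arrays ?s1 ''rep'' (l * (n + 1) + 1 + j) = fst (S l) j)"
      using w l by (fastforce simp: stores_rows_def evaluator_input_def)
  qed
  have "runs u (Seq kernel_pass (RAssign ''out'' (RDivide (RPlus (RVar ''sum'') (ROracle (RVar ''p'')))
       (ROfNat (NPlus (NVar ''rows'') (NConst 1)))))) (B - 2) ?s1
     (\<lambda>s. reals s ''out'' = averaged u n lam T m S x)"
  proof (rule runs_Seq)
    show "runs u kernel_pass (m * (3 * n + 12) + 6) ?s1 (\<lambda>s'. reals s' ''p'' = iterate u n lam T S m x \<and>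
      reals s' ''sum'' = (\<Sum>i<m. u (iterate u n lam T S i x)) \<and> nats s' ''rows'' = m)"
      using fS by (intro runs_kernel_pass[where r = m and S = S and x = x and n = n and lam = lam and T = T] st)
        (auto simp: evaluator_input_def T x)
    show "m * (3 * n + 12) + 6 \<le> B - 2" using time by simp
    fix s' :: state
    assume "reals s' ''p'' = iterate u n lam T S m x \<and>
      reals s' ''sum'' = (\<Sum>i<m. u (iterate u n lam T S i x)) \<and> nats s' ''rows'' = m"
    thus "runs u (RAssign ''out'' (RDivide (RPlus (RVar ''sum'') (ROracle (RVar ''p'')))
       (ROfNat (NPlus (NVar ''rows'') (NConst 1))))) (B - 2 - (m * (3 * n + 12) + 6)) s'
      (\<lambda>s. reals s ''out'' = averaged u n lam T m S x)"
      \<comment> \<open>The sum over \<open>i < m\<close> and the value of the oracle at iterate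
        \<open>m\<close> combine to the sum over \<open>i \<le> m\<close>.\<close>
      using time by (intro runs_RAssign) (auto simp: averaged_def add.commute simp flip: lessThan_Suc_atMost)
  qed
  moreover have "?s1 = (let s = ?s\<lparr>nats := (nats ?s)(''lim'' := nval (NMinus (NVar ''len'') (NConst 1)) ?s)\<rparr>
     in s\<lparr>reals := (reals s)(''beta'' := rval u (RCell ''rep'' (NVar ''lim'')) s)\<rparr>)"
    using w by (simp add: evaluator_input_def)
  ultimately show ?thesis
    unfolding evaluator_def block.simps Let_def
    using time by (intro runs_step) (auto simp: numeral_2_eq_2)
qed

definition hypothesis ::
    "nat \<Rightarrow> (real \<Rightarrow> real) \<Rightarrow> nat \<Rightarrow> nat \<Rightarrow> real \<Rightarrow> real \<Rightarrow> real \<Rightarrow> nat \<Rightarrow> sample \<Rightarrow> vec \<Rightarrow> real" where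
  "hypothesis A u n k L \<epsilon> \<delta> m S =
     averaged u n (step_size k L \<epsilon>) (block_length (block_bound A k L \<epsilon>)) m S"

lemma outputs_hypothesis:
  assumes S: "\<And>i. i < m \<Longrightarrow> S i \<in> unit_sphere n \<times> {0..1}" and n: "1 \<le> n"
  shows "outputs_hypothesis (learner A) evaluator u n k L \<epsilon> \<delta> m S (100 * (m + n + 1) ^ 100)
    (hypothesis A u n k L \<epsilon> \<delta> m S)"
proof -
  let ?B = "100 * (m + n + 1) ^ 100" and ?\<beta> = "block_bound A k L \<epsilon>"
  let ?R = "\<lambda>rep. stores_rows rep n m (coefficient u n (step_size k L \<epsilon>) (block_length ?\<beta>) S) (\<lambda>i. fst (S i))"
  define N where "N = m + n + 1"
  have "1 \<le> N" "m \<le> N" "n \<le> N" by (auto simp: N_def)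
  have N3: "a * (b * c) \<le> N ^ 3" if "a \<le> N" "b \<le> N" "c \<le> N" for a b c
    using that by (auto simp: eval_nat_numeral intro!: mult_le_mono)
  \<comment> \<open>Every monomial is padded with ones to a product of three factors, each at most
    \<open>N\<close>.\<close>
  have "m * (m * (3 * n + 12) + 3 * n + 13) + 9 = 3 * (m * (m * n)) + 12 * (m * (m * 1)) + 3 * (m * (n * 1)) + 13 * (m * (1 * 1)) + 9 * (1 * (1 * 1))"
    by (simp add: algebra_simps)
  also have "\<dots> \<le> 3 * N ^ 3 + 12 * N ^ 3 + 3 * N ^ 3 + 13 * N ^ 3 + 9 * N ^ 3"
    using \<open>1 \<le> N\<close> \<open>m \<le> N\<close> \<open>n \<le> N\<close> by (intro add_mono mult_left_mono N3) auto
  also have "\<dots> \<le> 100 * N ^ 3" by simp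
  \<comment> \<open>The time is cubic; the larger exponent appears because one number serves as both
    factor and exponent.\<close>
  also have "\<dots> \<le> 100 * N ^ 100" using \<open>1 \<le> N\<close> by (intro mult_left_mono power_increasing) auto
  finally have B: "m * (m * (3 * n + 12) + 3 * n + 13) + 9 \<le> ?B" by (simp add: N_def)
  have B2: "m * (3 * n + 12) + 9 \<le> ?B" "m * (n + 1) + 1 \<le> ?B"
  proof -
    have "m * (3 * n + 12) \<le> m * (m * (3 * n + 12) + 3 * n + 13)" by (intro mult_left_mono) auto
    with B show "m * (3 * n + 12) + 9 \<le> ?B" by linarith
    have "m * (n + 1) \<le> m * (3 * n + 12)" by (intro mult_left_mono) auto
    with \<open>m * (3 * n + 12) + 9 \<le> ?B\<close> show "m * (n + 1) + 1 \<le> ?B" by linarith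
  qed
  have "runs u (learner A) ?B (learner_input n k L \<epsilon> \<delta> m S)
    (\<lambda>s. nats s ''len'' = m * (n + 1) + 1 \<and> arrays s ''rep'' (m * (n + 1)) = ?\<beta> \<and> ?R (arrays s ''rep''))"
    using B by (intro runs_learner S n) auto
  then obtain t s where ts: "exec u (learner A) (learner_input n k L \<epsilon> \<delta> m S) t s" "t \<le> ?B"
    and s: "nats s ''len'' = m * (n + 1) + 1" "arrays s ''rep'' (m * (n + 1)) = ?\<beta>" "?R (arrays s ''rep'')"
    unfolding runs_def by blast
  define w where "w = learner_output s"
  have len: "length w = m * (n + 1) + 1" using s by (simp add: w_def learner_output_def)
  have w: "w ! i = arrays s ''rep'' i" if "i < m * (n + 1) + 1" for i
    using that s by (simp add: w_def learner_output_def del: upt_Suc)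
  have "?R (\<lambda>i. w ! i)"
    unfolding stores_rows_def
  proof (intro allI impI)
    fix l assume l: "l < m"
    have "l * (n + 1) < m * (n + 1) + 1" using mult_strict_right_mono[OF l, of "n + 1"] by linarith
    moreover have "l * (n + 1) + 1 + j < m * (n + 1) + 1" if "j < n" for j
      using row_index_less[OF l that] by simp
    ultimately show "w ! (l * (n + 1)) = coefficient u n (step_size k L \<epsilon>) (block_length ?\<beta>) S l \<and>
      (\<forall>j<n. w ! (l * (n + 1) + 1 + j) = fst (S l) j)"
      using s(3) l w unfolding stores_rows_def by metis
  qed
  moreover have "w ! (m * (n + 1)) = ?\<beta>" using s w by simp
  ultimately have "runs u evaluator ?B (evaluator_input n w x)
      (\<lambda>s. reals s ''out'' = hypothesis A u n k L \<epsilon> \<delta> m S x)" if "x \<in> unit_sphere n" for x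
    unfolding hypothesis_def using S that len B2 by (intro runs_evaluator) auto
  thus ?thesis
    unfolding outputs_hypothesis_def runs_def evaluator_output_def
    using ts len B2 unfolding w_def by (metis (no_types, lifting))
qed

section \<open>Regret of the predictors\<close>

text \<open>As \<open>F\<close> ignores coordinate \<open>i\<close> of the sample, that coordinate
  acts as a fresh independent draw: by Fubini both sides equal the integral over the remaining
  coordinates and one point of \<open>D\<close>. It is applied to the predictor before a step and
  the sample used in that step.\<close>

lemma integral_resample:
  fixes F :: "('i \<Rightarrow> 'a) \<Rightarrow> 'a \<Rightarrow> real"
  assumes D: "prob_space D" and I: "finite I" "i \<in> I"
    and F: "case_prod F \<in> borel_measurable (PiM I (\<lambda>_. D) \<Otimes>\<^sub>M D)"
    and bound: "\<And>S z. \<bar>F S z\<bar> \<le> C"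
    and F_upd: "\<And>S y z. F (S(i := y)) z = F S z"
  shows "(\<integral>S. F S (S i) \<partial>PiM I (\<lambda>_. D)) = (\<integral>S. (\<integral>z. F S z \<partial>D) \<partial>PiM I (\<lambda>_. D))"
proof -
  interpret D: prob_space D by fact
  interpret product_sigma_finite "\<lambda>_. D" by unfold_locales
  interpret P: prob_space "PiM I (\<lambda>_. D)" by (rule prob_space_PiM) (rule D)
  define J where "J = I - {i}"
  have J: "finite J" "i \<notin> J" "insert i J = I" using I by (auto simp: J_def)
  have [measurable]: "(\<lambda>S. S i) \<in> PiM I (\<lambda>_. D) \<rightarrow>\<^sub>M D"
    using I(2) by (rule measurable_component_singleton)
  have "(\<lambda>S. (S, S i)) \<in> PiM I (\<lambda>_. D) \<rightarrow>\<^sub>M PiM I (\<lambda>_. D) \<Otimes>\<^sub>M D"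
    by measurable
  from measurable_compose[OF this F]
  have int1: "integrable (PiM I (\<lambda>_. D)) (\<lambda>S. F S (S i))"
    using bound by (intro P.integrable_const_bound[where B = C]) auto
  have int2: "integrable (PiM I (\<lambda>_. D)) (\<lambda>S. \<integral>z. F S z \<partial>D)"
  proof (intro P.integrable_const_bound[where B = C] AE_I2)
    show "(\<lambda>S. \<integral>z. F S z \<partial>D) \<in> borel_measurable (PiM I (\<lambda>_. D))"
      using F by (rule D.borel_measurable_lebesgue_integral)
    fix S show "norm (\<integral>z. F S z \<partial>D) \<le> C"
    proof -
      have "norm (\<integral>z. F S z \<partial>D) \<le> (\<integral>z. norm (F S z) \<partial>D)" by (rule integral_norm_bound)
      also have "\<dots> \<le> (\<integral>z. C \<partial>D)"
        using bound[of S] order_trans[OF abs_ge_zero bound] by (intro integral_mono_AE') auto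
      finally show ?thesis by (simp add: D.prob_space)
    qed
  qed
  have "(\<integral>S. F S (S i) \<partial>PiM I (\<lambda>_. D)) = (\<integral>S. (\<integral>y. F S y \<partial>D) \<partial>PiM J (\<lambda>_. D))"
    using product_integral_insert[OF J(1,2), of "\<lambda>S. F S (S i)"] int1 by (simp add: J(3) F_upd)
  moreover have "(\<integral>S. (\<integral>z. F S z \<partial>D) \<partial>PiM I (\<lambda>_. D)) = (\<integral>S. (\<integral>y. F S y \<partial>D) \<partial>PiM J (\<lambda>_. D))"
    using product_integral_insert[OF J(1,2), of "\<lambda>S. \<integral>z. F S z \<partial>D"] int2
    by (simp add: J(3) F_upd D.prob_space)
  ultimately show ?thesis by simp
qed

section \<open>Measurability of kernel, inner layer and predictors\<close>

lemma component_measurable: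
  assumes "f \<in> M \<rightarrow>\<^sub>M vec_space n" "j < n"
  shows "(\<lambda>\<omega>. f \<omega> j) \<in> borel_measurable M"
  using measurable_compose[OF assms(1)[unfolded vec_space_def] measurable_component_singleton] assms(2)
  by simp

lemma inner_prod_measurable:
  assumes "f \<in> M \<rightarrow>\<^sub>M vec_space n" "g \<in> M \<rightarrow>\<^sub>M vec_space n"
  shows "(\<lambda>\<omega>. inner_prod n (f \<omega>) (g \<omega>)) \<in> borel_measurable M"
  unfolding inner_prod_def
  by (intro borel_measurable_sum borel_measurable_times component_measurable[OF assms(1)]
      component_measurable[OF assms(2)]) auto

lemma kernel_measurable:
  assumes "f \<in> M \<rightarrow>\<^sub>M vec_space n" "g \<in> M \<rightarrow>\<^sub>M vec_space n"
  shows "(\<lambda>\<omega>. kernel n (f \<omega>) (g \<omega>)) \<in> borel_measurable M"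
  using inner_prod_measurable[OF assms] unfolding kernel_def by measurable

lemma inner_layer_measurable:
  assumes "f \<in> M \<rightarrow>\<^sub>M vec_space n"
  shows "(\<lambda>\<omega>. inner_layer n k a b (f \<omega>)) \<in> borel_measurable M"
proof -
  have "(\<lambda>\<omega>. inner_prod n (a i) (f \<omega>)) \<in> borel_measurable M" for i
    unfolding inner_prod_def
    by (intro borel_measurable_sum borel_measurable_times component_measurable[OF assms] borel_measurable_const) auto
  thus ?thesis unfolding inner_layer_def sigmoid_def by measurable
qed

text \<open>Sample and query point both vary with \<omega>. The induction needs this, because an
  update evaluates the earlier predictor at a point of the sample itself.\<close>

lemma predictor_measurable:
  assumes u: "u \<in> borel_measurable borel"
    and S: "\<And>s. s < t \<Longrightarrow> (\<lambda>\<omega>. S \<omega> s) \<in> M \<rightarrow>\<^sub>M example_space n"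
    and x: "x \<in> M \<rightarrow>\<^sub>M vec_space n"
  shows "(\<lambda>\<omega>. predictor u n lam (S \<omega>) t (x \<omega>)) \<in> borel_measurable M"
  using S x
proof (induction t arbitrary: x)
  case 0
  then show ?case by simp
next
  case (Suc t)
  have [measurable]: "(\<lambda>\<omega>. S \<omega> t) \<in> M \<rightarrow>\<^sub>M vec_space n \<Otimes>\<^sub>M borel"
    using Suc.prems(1)[of t] by (simp add: example_space_def)
  have f: "(\<lambda>\<omega>. fst (S \<omega> t)) \<in> M \<rightarrow>\<^sub>M vec_space n" by measurable
  note [measurable] = Suc.IH[OF Suc.prems(1) f] Suc.IH[OF Suc.prems] kernel_measurable[OF f Suc.prems(2)] u
  show ?case by simp
qed

section \<open>Corrections and the regret of one block\<close>

lemma predictor_cong: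
  assumes "\<And>s. s < t \<Longrightarrow> S s = S' s"
  shows "predictor u n lam S t = predictor u n lam S' t"
  using assms by (induction t) (auto simp: fun_eq_iff)

text \<open>The counterpart of \<open>coefficient\<close> with samples numbered from the start of a
  block.\<close>

definition correction :: "(real \<Rightarrow> real) \<Rightarrow> nat \<Rightarrow> real \<Rightarrow> sample \<Rightarrow> nat \<Rightarrow> real" where
  "correction u n lam S t = lam * (max 0 (min 1 (snd (S t))) - u (predictor u n lam S t (fst (S t))))"

lemma correction_bound:
  assumes "range u \<subseteq> {0..1}" "0 \<le> lam"
  shows "\<bar>correction u n lam S t\<bar> \<le> lam"
proof -
  have "u p \<in> {0..1}" for p by (meson assms(1) rangeI subsetD)
  hence "\<bar>max 0 (min 1 (snd (S t))) - u (predictor u n lam S t (fst (S t)))\<bar> \<le> 1"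
    unfolding atLeastAtMost_iff by (smt (verit))
  thus ?thesis using assms(2) by (simp add: correction_def abs_mult mult_left_le)
qed

lemma predictor_eq_sum:
  "predictor u n lam S t x = (\<Sum>s<t. correction u n lam S s * kernel n (fst (S s)) x)"
  by (induction t) (auto simp: correction_def)

lemma predictor_bound:
  assumes "range u \<subseteq> {0..1}" "0 \<le> lam"
  shows "\<bar>predictor u n lam S t x\<bar> \<le> 2 * lam * real t"
proof -
  have "\<bar>predictor u n lam S t x\<bar> \<le> (\<Sum>s<t. \<bar>correction u n lam S s * kernel n (fst (S s)) x\<bar>)"
    unfolding predictor_eq_sum by (rule sum_abs)
  also have "\<dots> \<le> (\<Sum>s<t. lam * 2)"
    unfolding abs_mult using correction_bound[OF assms] assms(2)
    by (intro sum_mono mult_mono) (auto simp: abs_of_pos[OF kernel_pos] kernel_le_2 less_imp_le[OF kernel_pos])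
  finally show ?thesis by (simp add: mult_ac)
qed

text \<open>The quadratic form is \<open>\<parallel>w\<^sub>T - v\<parallel>\<^sup>2 - \<parallel>v\<parallel>\<^sup>2\<close> for the predictor \<open>w\<^sub>T\<close> and the target \<open>v\<close> in
  the feature space, the right-hand side adds up its increments.\<close>

lemma predictor_potential:
  "(\<Sum>s<T. \<Sum>t<T. correction u n lam S s * correction u n lam S t * kernel n (fst (S s)) (fst (S t)))
     - 2 * (\<Sum>s<T. correction u n lam S s * g (fst (S s)))
   = (\<Sum>t<T. 2 * correction u n lam S t * (predictor u n lam S t (fst (S t)) - g (fst (S t)))
       + (correction u n lam S t)\<^sup>2 * kernel n (fst (S t)) (fst (S t)))"
proof (induction T)
  case 0
  then show ?case by simp
next
  case (Suc T)
  let ?c = "correction u n lam S" and ?K = "\<lambda>s t. kernel n (fst (S s)) (fst (S t))"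
  have "(\<Sum>s<Suc T. \<Sum>t<Suc T. ?c s * ?c t * ?K s t)
    = (\<Sum>s<T. \<Sum>t<T. ?c s * ?c t * ?K s t) + (\<Sum>s<T. ?c s * ?c T * ?K s T)
      + ((\<Sum>t<T. ?c T * ?c t * ?K T t) + ?c T * ?c T * ?K T T)"
    by (simp add: sum.distrib)
  also have "(\<Sum>t<T. ?c T * ?c t * ?K T t) = (\<Sum>s<T. ?c s * ?c T * ?K s T)"
    by (intro sum.cong refl) (simp add: kernel_commute mult_ac)
  also have "(\<Sum>s<T. ?c s * ?c T * ?K s T) = ?c T * predictor u n lam S T (fst (S T))"
    by (simp add: predictor_eq_sum sum_distrib_left mult_ac)
  finally show ?case using Suc.IH by (simp add: algebra_simps power2_eq_square)
qed

text \<open>The squared distance between the last predictor and the target is nonnegative and starts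
  at no more than the final summand. By \<open>predictor_potential\<close> it changes by the linear
  terms plus squared corrections times kernel values, and the latter are at most
  \<open>2 * lam\<^sup>2\<close> per step.\<close>

lemma predictor_regret:
  assumes u: "range u \<subseteq> {0..1}" and lam: "0 \<le> lam"
    and c: "summable (\<lambda>d. (c d)\<^sup>2 * 2 ^ d)"
      "\<And>z. \<bar>z\<bar> \<le> 1 \<Longrightarrow> (\<lambda>d. c d * z ^ d) sums sigmoid z"
    and a: "\<And>i. i < k \<Longrightarrow> a i \<in> unit_sphere n" and b: "b \<in> unit_sphere k"
    and x: "\<And>s. s < T \<Longrightarrow> fst (S s) \<in> unit_sphere n"
  shows "0 \<le> (\<Sum>t<T. 2 * correction u n lam S t *
       (predictor u n lam S t (fst (S t)) - inner_layer n k a b (fst (S t))))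
     + 2 * real T * lam\<^sup>2 + (\<Sum>d. (c d)\<^sup>2 * 2 ^ d) * real k"
proof -
  let ?c = "correction u n lam S" and ?g = "inner_layer n k a b"
  have "0 \<le> (\<Sum>s<T. \<Sum>t<T. ?c s * ?c t * kernel n (fst (S s)) (fst (S t)))
     - 2 * (\<Sum>s<T. ?c s * ?g (fst (S s))) + (\<Sum>d. (c d)\<^sup>2 * 2 ^ d) * real k"
    by (rule inner_layer_rkhs[OF c a b]) (use x in auto)
  also have "\<dots> = (\<Sum>t<T. 2 * ?c t * (predictor u n lam S t (fst (S t)) - ?g (fst (S t)))
       + (?c t)\<^sup>2 * kernel n (fst (S t)) (fst (S t))) + (\<Sum>d. (c d)\<^sup>2 * 2 ^ d) * real k"
    by (simp only: predictor_potential)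
  also have "\<dots> \<le> (\<Sum>t<T. 2 * ?c t * (predictor u n lam S t (fst (S t)) - ?g (fst (S t)))
       + lam\<^sup>2 * 2) + (\<Sum>d. (c d)\<^sup>2 * 2 ^ d) * real k"
    using correction_bound[OF u lam] kernel_le_2 kernel_pos lam
    by (intro add_right_mono sum_mono add_left_mono mult_mono)
      (auto simp: less_imp_le abs_le_square_iff[symmetric])
  also have "\<dots> = (\<Sum>t<T. 2 * ?c t * (predictor u n lam S t (fst (S t)) - ?g (fst (S t))))
     + 2 * real T * lam\<^sup>2 + (\<Sum>d. (c d)\<^sup>2 * 2 ^ d) * real k"
    by (simp only: sum.distrib) simp
  finally show ?thesis .
qed

section \<open>Expected error and concentration\<close>

locale network_distribution =
  fixes n k :: nat and L :: real and u :: "real \<Rightarrow> real" and a :: "nat \<Rightarrow> vec" and b :: vec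
    and D :: "(vec \<times> real) measure"
  assumes activation: "activation L u"
    and a: "i < k \<Longrightarrow> a i \<in> unit_sphere n" and b: "b \<in> unit_sphere k"
    and D: "labelled_distribution n D"
    and mean: "conditional_mean n D (net2 u n k a b)"
begin

sublocale prob_space D using D by (simp add: labelled_distribution_def)

definition target :: "vec \<Rightarrow> real" where "target = inner_layer n k a b"

definition squared_error :: "(vec \<Rightarrow> real) \<Rightarrow> real" where
  "squared_error h = (\<integral>z. (h (fst z) - u (target (fst z)))\<^sup>2 \<partial>D)"

lemma net2_eq: "net2 u n k a b x = u (target x)"
  by (simp add: net2_def target_def inner_layer_def)

lemma range_u: "range u \<subseteq> {0..1}"
  using activation by (simp add: activation_def)

lemma u_range: "0 \<le> u p" "u p \<le> 1"
  using range_u by (auto simp: image_subset_iff)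

lemma u_measurable [measurable]: "u \<in> borel_measurable borel"
  using activation by (intro borel_measurable_mono) (simp add: activation_def)

lemma sets_D [measurable_cong]: "sets D = sets (vec_space n \<Otimes>\<^sub>M borel)"
  using D by (simp add: labelled_distribution_def example_space_def)

lemma target_measurable [measurable]: "target \<in> borel_measurable (vec_space n)"
  unfolding target_def using inner_layer_measurable[OF measurable_ident] by simp

lemma target_bound: "\<bar>target x\<bar> \<le> (\<Sum>i<k. \<bar>b i\<bar>)"
proof -
  have "0 \<le> sigmoid z" "sigmoid z \<le> 1" for z
    by (simp_all add: sigmoid_def divide_simps add_pos_pos)
  hence "\<bar>b i * sigmoid z\<bar> \<le> \<bar>b i\<bar>" for i z
    by (simp add: abs_mult mult_left_le)
  thus ?thesis unfolding target_def inner_layer_def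
    by (intro order_trans[OF sum_abs sum_mono]) auto
qed

lemma AE_sphere: "AE z in D. fst z \<in> unit_sphere n \<and> snd z \<in> {0..1}"
  using D by (auto simp: labelled_distribution_def mem_Times_iff)

text \<open>The tower property: tested against a bounded function of the point, a label can be
  exchanged for its conditional mean. Clipping changes labels only on a null set.\<close>

lemma label_integral:
  assumes \<phi>: "\<phi> \<in> borel_measurable (vec_space n)" and bound: "\<And>x. \<bar>\<phi> x\<bar> \<le> C"
  shows "(\<integral>z. max 0 (min 1 (snd z)) * \<phi> (fst z) \<partial>D) = (\<integral>z. u (target (fst z)) * \<phi> (fst z) \<partial>D)"
proof -
  define G where "G = vimage_algebra (space D) fst (vec_space n)"
  have fst: "fst \<in> D \<rightarrow>\<^sub>M vec_space n" by measurable
  have "subalgebra D G"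
    unfolding subalgebra_def G_def using fst by (simp add: measurable_iff_sets)
  then interpret finite_measure_subalgebra D G by unfold_locales
  have [measurable]: "fst \<in> G \<rightarrow>\<^sub>M vec_space n"
    unfolding G_def using measurable_space[OF fst] by (intro measurable_vimage_algebra1) auto
  note [measurable] = \<phi>
  have \<phi>G: "(\<lambda>z. \<phi> (fst z)) \<in> borel_measurable G" by measurable
  have ae: "AE z in D. max 0 (min 1 (snd z)) * \<phi> (fst z) = \<phi> (fst z) * snd z"
    using AE_sphere by eventually_elim auto
  have int: "integrable D (\<lambda>z. \<phi> (fst z) * snd z)"
  proof (rule integrable_const_bound)
    show "AE z in D. norm (\<phi> (fst z) * snd z) \<le> C"
      using AE_sphere
    proof eventually_elim
      case (elim z)
      hence "\<bar>\<phi> (fst z)\<bar> * \<bar>snd z\<bar> \<le> \<bar>\<phi> (fst z)\<bar>" by (intro mult_left_le) auto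
      with bound[of "fst z"] show ?case by (simp add: abs_mult)
    qed
  qed measurable
  have "(\<integral>z. max 0 (min 1 (snd z)) * \<phi> (fst z) \<partial>D) = (\<integral>z. \<phi> (fst z) * snd z \<partial>D)"
    using ae by (intro integral_cong_AE) measurable
  also have "\<dots> = (\<integral>z. \<phi> (fst z) * real_cond_exp D G snd z \<partial>D)"
    using real_cond_exp_intg(2)[OF int \<phi>G] by simp
  also have "\<dots> = (\<integral>z. u (target (fst z)) * \<phi> (fst z) \<partial>D)"
  proof (rule integral_cong_AE)
    show "AE z in D. \<phi> (fst z) * real_cond_exp D G snd z = u (target (fst z)) * \<phi> (fst z)"
      using mean unfolding conditional_mean_def G_def[symmetric] by (simp add: net2_eq) (auto elim: eventually_mono)
  qed measurable
  finally show ?thesis .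
qed

lemma squared_error_range:
  assumes [measurable]: "h \<in> borel_measurable (vec_space n)" and h: "\<And>x. 0 \<le> h x \<and> h x \<le> 1"
  shows "integrable D (\<lambda>z. (h (fst z) - u (target (fst z)))\<^sup>2)" "0 \<le> squared_error h" "squared_error h \<le> 1"
proof -
  have "\<bar>h x - u (target x)\<bar> \<le> 1" for x
    using h[of x] u_range[of "target x"] by linarith
  hence le: "(h x - u (target x))\<^sup>2 \<le> 1" for x by (simp add: abs_square_le_1)
  show int: "integrable D (\<lambda>z. (h (fst z) - u (target (fst z)))\<^sup>2)"
    using le by (intro integrable_const_bound[where B = 1]) auto
  show "0 \<le> squared_error h" unfolding squared_error_def by simp
  have "squared_error h \<le> (\<integral>z. 1 \<partial>D)"
    unfolding squared_error_def using int le by (intro integral_mono) auto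
  thus "squared_error h \<le> 1" by (simp add: prob_space)
qed

text \<open>The expected update direction makes progress proportional to the squared error.
  \<open>label_integral\<close> replaces the label by \<open>u\<close> at the target, and
  \<open>activation_gap\<close> then applies pointwise. Boundedness of \<open>w\<close> makes all
  integrals finite.\<close>

lemma surrogate_le:
  assumes [measurable]: "w \<in> borel_measurable (vec_space n)" and w: "\<And>x. \<bar>w x\<bar> \<le> C"
  shows "L * (\<integral>z. (max 0 (min 1 (snd z)) - u (w (fst z))) * (w (fst z) - target (fst z)) \<partial>D)
     \<le> - squared_error (\<lambda>x. u (w x))"
proof -
  let ?G = "C + (\<Sum>i<k. \<bar>b i\<bar>)"
  have C: "\<bar>w x - target x\<bar> \<le> ?G" for x
    using w[of x] target_bound[of x] by linarith
  have C': "\<bar>y * (w x - target x)\<bar> \<le> ?G" if "\<bar>y\<bar> \<le> 1" for x y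
    using mult_mono[OF that C] by (simp add: abs_mult order_trans[OF abs_ge_zero C])
  have bounded_int: "integrable D (\<lambda>z. v z * (w (fst z) - target (fst z)))"
    if [measurable]: "v \<in> borel_measurable D" and v: "\<And>z. \<bar>v z\<bar> \<le> 1" for v
  proof (rule integrable_const_bound[where B = ?G])
    show "AE z in D. norm (v z * (w (fst z) - target (fst z))) \<le> ?G"
      unfolding real_norm_def by (intro AE_I2 C' v)
  qed measurable
  have "\<bar>u p\<bar> \<le> 1" for p using u_range by simp
  hence int: "integrable D (\<lambda>z. max 0 (min 1 (snd z)) * (w (fst z) - target (fst z)))"
    "integrable D (\<lambda>z. u (w (fst z)) * (w (fst z) - target (fst z)))"
    "integrable D (\<lambda>z. u (target (fst z)) * (w (fst z) - target (fst z)))"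
    by (auto intro!: bounded_int)
  have "(\<integral>z. (max 0 (min 1 (snd z)) - u (w (fst z))) * (w (fst z) - target (fst z)) \<partial>D)
    = (\<integral>z. max 0 (min 1 (snd z)) * (w (fst z) - target (fst z)) \<partial>D)
      - (\<integral>z. u (w (fst z)) * (w (fst z) - target (fst z)) \<partial>D)"
    unfolding left_diff_distrib[of "max _ _"] by (rule Bochner_Integration.integral_diff[OF int(1,2)])
  also have "(\<integral>z. max 0 (min 1 (snd z)) * (w (fst z) - target (fst z)) \<partial>D)
    = (\<integral>z. u (target (fst z)) * (w (fst z) - target (fst z)) \<partial>D)"
    by (rule label_integral[where C = ?G]) (measurable, rule C)
  finally have eq: "(\<integral>z. (max 0 (min 1 (snd z)) - u (w (fst z))) * (w (fst z) - target (fst z)) \<partial>D)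
    = (\<integral>z. u (target (fst z)) * (w (fst z) - target (fst z)) \<partial>D)
      - (\<integral>z. u (w (fst z)) * (w (fst z) - target (fst z)) \<partial>D)" .
  have eq': "(\<integral>z. L * ((u (w (fst z)) - u (target (fst z))) * (w (fst z) - target (fst z))) \<partial>D)
    = L * ((\<integral>z. u (w (fst z)) * (w (fst z) - target (fst z)) \<partial>D)
      - (\<integral>z. u (target (fst z)) * (w (fst z) - target (fst z)) \<partial>D))"
    unfolding left_diff_distrib[of "u _" "u _"] using int(2,3) by simp
  have "squared_error (\<lambda>x. u (w x)) \<le> (\<integral>z. L * ((u (w (fst z)) - u (target (fst z))) * (w (fst z) - target (fst z))) \<partial>D)"
    unfolding squared_error_def
  proof (rule integral_mono)
    show "integrable D (\<lambda>z. (u (w (fst z)) - u (target (fst z)))\<^sup>2)"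
      using u_range by (intro squared_error_range(1)) auto
    show "integrable D (\<lambda>z. L * ((u (w (fst z)) - u (target (fst z))) * (w (fst z) - target (fst z))))"
      unfolding left_diff_distrib[of "u _" "u _"] using int by simp
  qed (rule activation_gap[OF activation])
  moreover have "L * (y - x) \<le> - s" if "s \<le> L * (x - y)" for s x y
    using that by (simp add: algebra_simps)
  ultimately show ?thesis unfolding eq eq' by blast
qed

section \<open>Random samples, block errors and their concentration\<close>

abbreviation samples :: "nat set \<Rightarrow> sample measure" where "samples I \<equiv> PiM I (\<lambda>_. D)"

lemma prob_samples: "prob_space (samples I)"
  by (intro prob_space_PiM) unfold_locales

lemma coordinate_measurable: "i \<in> I \<Longrightarrow> (\<lambda>S. S i) \<in> samples I \<rightarrow>\<^sub>M example_space n"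
  using measurable_component_singleton[of i I "\<lambda>_. D"]
  by (simp add: measurable_cong_sets[OF refl sets_D] example_space_def)

lemma predictor_sample_measurable:
  assumes "\<And>s. s < t \<Longrightarrow> r + s \<in> I"
  shows "(\<lambda>(S, z). predictor u n lam (\<lambda>s. S (r + s)) t (fst z)) \<in> borel_measurable (samples I \<Otimes>\<^sub>M D)"
proof -
  have "(\<lambda>\<omega>. predictor u n lam (\<lambda>s. fst \<omega> (r + s)) t (fst (snd \<omega>))) \<in> borel_measurable (samples I \<Otimes>\<^sub>M D)"
    by (intro predictor_measurable u_measurable measurable_compose[OF measurable_fst coordinate_measurable] assms)
      measurable
  thus ?thesis by (simp add: case_prod_beta')
qed

lemma predictor_measurable_vec [measurable]:
  "predictor u n lam S t \<in> borel_measurable (vec_space n)"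
proof (induction t)
  case (Suc t)
  have [measurable]: "(\<lambda>x. x j) \<in> borel_measurable (vec_space n)" if "j < n" for j
    using component_measurable[of "\<lambda>x. x" "vec_space n" n j] that by simp
  have "(\<lambda>x. kernel n (fst (S t)) x) \<in> borel_measurable (vec_space n)"
    unfolding kernel_def inner_prod_def
    by (intro borel_measurable_divide borel_measurable_diff borel_measurable_max borel_measurable_min
      borel_measurable_sum borel_measurable_times borel_measurable_const) auto
  with Suc show ?case by simp
qed simp

definition block_error :: "real \<Rightarrow> nat \<Rightarrow> nat \<Rightarrow> sample \<Rightarrow> real" where
  "block_error lam T r S =
     (\<Sum>t<T. squared_error (\<lambda>x. u (predictor u n lam (\<lambda>s. S (r * T + s)) t x))) / real T"

lemma error_measurable:
  assumes "\<And>s. s < t \<Longrightarrow> r + s \<in> I"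
  shows "(\<lambda>S. squared_error (\<lambda>x. u (predictor u n lam (\<lambda>s. S (r + s)) t x))) \<in> borel_measurable (samples I)"
proof -
  note [measurable] = predictor_sample_measurable[OF assms, where lam = lam]
  have "(\<lambda>(S, z). (u (predictor u n lam (\<lambda>s. S (r + s)) t (fst z)) - u (target (fst z)))\<^sup>2)
      \<in> borel_measurable (samples I \<Otimes>\<^sub>M D)" by measurable
  thus ?thesis unfolding squared_error_def by (rule borel_measurable_lebesgue_integral)
qed

lemma block_error_measurable:
  assumes "{r * T..<r * T + T} \<subseteq> I"
  shows "block_error lam T r \<in> borel_measurable (samples I)"
  unfolding block_error_def
  by (intro borel_measurable_divide borel_measurable_sum error_measurable borel_measurable_const)
    (use assms in auto)

lemma block_error_range: "0 \<le> block_error lam T r S" "block_error lam T r S \<le> 1"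
proof -
  have e: "0 \<le> squared_error (\<lambda>x. u (predictor u n lam S' t x))"
    "squared_error (\<lambda>x. u (predictor u n lam S' t x)) \<le> 1" for S' t
    using u_range by (intro squared_error_range; simp)+
  show "0 \<le> block_error lam T r S" unfolding block_error_def by (intro divide_nonneg_nonneg sum_nonneg e) auto
  have "(\<Sum>t<T. squared_error (\<lambda>x. u (predictor u n lam (\<lambda>s. S (r * T + s)) t x))) \<le> (\<Sum>t<T. 1)"
    by (intro sum_mono e)
  thus "block_error lam T r S \<le> 1" unfolding block_error_def by (auto simp: divide_simps)
qed

text \<open>The expectation of the regret inequality over the sample: each linear term is evaluated
  with a fresh point by \<open>integral_resample\<close> and bounded by the negative expected error
  through \<open>surrogate_le\<close>. Dividing by \<open>2 * lam * T\<close> gives the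
  claim.\<close>

lemma expected_block_error:
  assumes c: "summable (\<lambda>d. (c d)\<^sup>2 * 2 ^ d)"
      "\<And>z. \<bar>z\<bar> \<le> 1 \<Longrightarrow> (\<lambda>d. c d * z ^ d) sums sigmoid z"
    and lam: "0 < lam" and T: "0 < T" and I: "{r * T..<r * T + T} \<subseteq> I" "finite I"
  shows "(\<integral>S. block_error lam T r S \<partial>samples I)
     \<le> L * ((\<Sum>d. (c d)\<^sup>2 * 2 ^ d) * real k / (2 * lam * real T) + lam)"
proof -
  interpret P: prob_space "samples I" by (rule prob_samples)
  let ?w = "\<lambda>S t. predictor u n lam (\<lambda>s. S (r * T + s)) t"
  let ?V = "(\<Sum>d. (c d)\<^sup>2 * 2 ^ d) * real k"
  have L: "0 \<le> L" using activation lipschitz_on_nonneg by (auto simp: activation_def)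
  define F where "F t S z = (max 0 (min 1 (snd z)) - u (?w S t (fst z))) * (?w S t (fst z) - target (fst z))"
    for t S z
  let ?C = "\<lambda>t. 2 * lam * real t + (\<Sum>i<k. \<bar>b i\<bar>)"
  have I': "r * T + t \<in> I" if "t < T" for t using I(1) that by auto
  have w_bound: "\<bar>?w S t x\<bar> \<le> 2 * lam * real t" for S t x
    using lam by (intro predictor_bound range_u) simp
  have F_bound: "\<bar>F t S z\<bar> \<le> ?C t" for t S z
  proof -
    have "\<bar>max 0 (min 1 (snd z)) - u (?w S t (fst z))\<bar> \<le> 1"
      using u_range[of "?w S t (fst z)"] by linarith
    moreover have "\<bar>?w S t (fst z) - target (fst z)\<bar> \<le> ?C t"
      using w_bound[of S t "fst z"] target_bound[of "fst z"] by linarith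
    ultimately have "\<bar>F t S z\<bar> \<le> 1 * ?C t" unfolding F_def abs_mult by (intro mult_mono) auto
    thus ?thesis by simp
  qed
  have F_meas: "case_prod (F t) \<in> borel_measurable (samples I \<Otimes>\<^sub>M D)" if "t < T" for t
  proof -
    have [measurable]: "(\<lambda>(S, z). ?w S t (fst z)) \<in> borel_measurable (samples I \<Otimes>\<^sub>M D)"
      using that by (intro predictor_sample_measurable I') auto
    show ?thesis unfolding F_def by measurable
  qed
  have F_int: "integrable (samples I) (\<lambda>S. F t S (S (r * T + t)))" if t: "t < T" for t
  proof (rule P.integrable_const_bound[where B = "?C t"])
    have "(\<lambda>S. S (r * T + t)) \<in> samples I \<rightarrow>\<^sub>M D"
      by (rule measurable_component_singleton) (rule I'[OF t])
    hence "(\<lambda>S. (S, S (r * T + t))) \<in> samples I \<rightarrow>\<^sub>M samples I \<Otimes>\<^sub>M D" by measurable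
    from measurable_compose[OF this F_meas[OF t]]
    show "(\<lambda>S. F t S (S (r * T + t))) \<in> borel_measurable (samples I)" by simp
  qed (use F_bound in auto)
  have err_int: "integrable (samples I) (\<lambda>S. squared_error (\<lambda>x. u (?w S t x)))" if "t < T" for t
    using that u_range by (intro P.integrable_const_bound[where B = 1] AE_I2 error_measurable I')
      (auto simp: squared_error_range)
  have step: "L * (\<integral>S. F t S (S (r * T + t)) \<partial>samples I) \<le> - (\<integral>S. squared_error (\<lambda>x. u (?w S t x)) \<partial>samples I)"
    if t: "t < T" for t
  proof -
    have upd: "F t (S(r * T + t := y)) z = F t S z" for S y z
    proof -
      \<comment> \<open>Predictor \<open>t\<close> reads only the first \<open>t\<close> samples of
        its block, so changing the sample used in step \<open>t\<close> has no effect on it.\<close>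
      have "?w (S(r * T + t := y)) t = ?w S t" by (rule predictor_cong) auto
      thus ?thesis by (simp add: F_def)
    qed
    have mi: "(\<lambda>S. \<integral>z. F t S z \<partial>D) \<in> borel_measurable (samples I)"
      using F_meas[OF t] by (rule borel_measurable_lebesgue_integral)
    have "L * (\<integral>S. F t S (S (r * T + t)) \<partial>samples I) = (\<integral>S. L * (\<integral>z. F t S z \<partial>D) \<partial>samples I)"
      using integral_resample[OF prob_space_axioms I(2) I'[OF t] F_meas[OF t] F_bound upd] by simp
    also have "\<dots> \<le> (\<integral>S. - squared_error (\<lambda>x. u (?w S t x)) \<partial>samples I)"
    proof (rule integral_mono)
      show "integrable (samples I) (\<lambda>S. L * (\<integral>z. F t S z \<partial>D))"
      proof (intro integrable_mult_right P.integrable_const_bound[where B = "?C t"] AE_I2 mi)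
        fix S
        have "norm (\<integral>z. F t S z \<partial>D) \<le> (\<integral>z. norm (F t S z) \<partial>D)" by (rule integral_norm_bound)
        also have "\<dots> \<le> (\<integral>z. ?C t \<partial>D)"
          using F_bound order_trans[OF abs_ge_zero F_bound] by (intro integral_mono_AE') auto
        finally show "norm (\<integral>z. F t S z \<partial>D) \<le> ?C t" by (simp add: prob_space)
      qed
      show "integrable (samples I) (\<lambda>S. - squared_error (\<lambda>x. u (?w S t x)))"
        using err_int[OF t] by simp
      fix S show "L * (\<integral>z. F t S z \<partial>D) \<le> - squared_error (\<lambda>x. u (?w S t x))"
        unfolding F_def by (rule surrogate_le[OF _ w_bound]) measurable
    qed
    finally show ?thesis by simp
  qed
  \<comment> \<open>The regret inequality holds for points on the sphere, hence only almost surely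
    in the sample.\<close>
  have sphere: "AE S in samples I. \<forall>i\<in>I. fst (S i) \<in> unit_sphere n"
    using I(2) by (intro eventually_ball_finite ballI AE_PiM_component prob_space_axioms)
      (auto intro: eventually_mono[OF AE_sphere])
  have "0 \<le> (\<integral>S. (\<Sum>t<T. 2 * lam * F t S (S (r * T + t))) + (2 * real T * lam\<^sup>2 + ?V) \<partial>samples I)"
  proof (rule integral_nonneg_AE)
    show "AE S in samples I. 0 \<le> (\<Sum>t<T. 2 * lam * F t S (S (r * T + t))) + (2 * real T * lam\<^sup>2 + ?V)"
      using sphere
    proof eventually_elim
      case (elim S)
      have "0 \<le> (\<Sum>t<T. 2 * correction u n lam (\<lambda>s. S (r * T + s)) t *
         (?w S t (fst (S (r * T + t))) - inner_layer n k a b (fst (S (r * T + t)))))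
         + 2 * real T * lam\<^sup>2 + ?V"
        using lam elim I' by (intro predictor_regret range_u c a b) auto
      also have "(\<Sum>t<T. 2 * correction u n lam (\<lambda>s. S (r * T + s)) t *
         (?w S t (fst (S (r * T + t))) - inner_layer n k a b (fst (S (r * T + t)))))
         = (\<Sum>t<T. 2 * lam * F t S (S (r * T + t)))"
        by (intro sum.cong refl) (simp add: F_def correction_def target_def mult.assoc)
      finally show ?case by (simp add: add.assoc)
    qed
  qed
  also have "\<dots> = 2 * lam * (\<Sum>t<T. \<integral>S. F t S (S (r * T + t)) \<partial>samples I) + (2 * real T * lam\<^sup>2 + ?V)"
    using F_int by (subst Bochner_Integration.integral_add)
      (auto simp: Bochner_Integration.integral_sum sum_distrib_left P.prob_space)
  \<comment> \<open>Multiplying by \<open>L\<close>, instead of dividing the errors by it, covers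
    \<open>L = 0\<close> as well.\<close>
  finally have "0 \<le> L * (2 * lam * (\<Sum>t<T. \<integral>S. F t S (S (r * T + t)) \<partial>samples I) + (2 * real T * lam\<^sup>2 + ?V))"
    using L by (intro mult_nonneg_nonneg)
  also have "\<dots> = 2 * lam * (\<Sum>t<T. L * (\<integral>S. F t S (S (r * T + t)) \<partial>samples I)) + L * (2 * real T * lam\<^sup>2 + ?V)"
    by (simp add: algebra_simps sum_distrib_left)
  also have "\<dots> \<le> 2 * lam * (\<Sum>t<T. - (\<integral>S. squared_error (\<lambda>x. u (?w S t x)) \<partial>samples I)) + L * (2 * real T * lam\<^sup>2 + ?V)"
    using step lam by (intro add_right_mono mult_left_mono sum_mono) auto
  finally have total: "2 * lam * (\<Sum>t<T. \<integral>S. squared_error (\<lambda>x. u (?w S t x)) \<partial>samples I) \<le> L * (2 * real T * lam\<^sup>2 + ?V)"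
    by (simp add: sum_negf)
  have "(\<integral>S. block_error lam T r S \<partial>samples I) = (\<Sum>t<T. \<integral>S. squared_error (\<lambda>x. u (?w S t x)) \<partial>samples I) / T"
    unfolding block_error_def using err_int by (simp add: Bochner_Integration.integral_sum)
  also have "\<dots> \<le> L * (2 * real T * lam\<^sup>2 + ?V) / (2 * lam * real T)"
    using total T lam by (simp add: field_simps)
  also have "\<dots> = L * (?V / (2 * lam * real T) + lam)"
    using T lam by (simp add: add_divide_distrib power2_eq_square distrib_left)
  finally show ?thesis .
qed

text \<open>The block errors are functions of disjoint ranges of samples, hence independent, and
  they lie in \<open>[0, 1]\<close>. Their means are at most \<open>\<epsilon> / 2\<close>, so
  Hoeffding's inequality is used for a deviation of \<open>\<epsilon> / 4\<close> per block.\<close>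

lemma block_errors_concentrate:
  assumes c: "summable (\<lambda>d. (c d)\<^sup>2 * 2 ^ d)"
      "\<And>z. \<bar>z\<bar> \<le> 1 \<Longrightarrow> (\<lambda>d. c d * z ^ d) sums sigmoid z"
    and lam: "0 < lam" and T: "0 < T" and R: "R * T \<le> m" "0 < R" and \<epsilon>: "0 < \<epsilon>"
    and small: "L * ((\<Sum>d. (c d)\<^sup>2 * 2 ^ d) * real k / (2 * lam * real T) + lam) \<le> \<epsilon> / 2"
  shows "measure (samples {..<m}) {S \<in> space (samples {..<m}). real R * (3 * \<epsilon> / 4) \<le> (\<Sum>r<R. block_error lam T r S)}
     \<le> exp (- (real R * \<epsilon>\<^sup>2 / 8))"
proof -
  let ?P = "samples {..<m}" and ?K = "\<lambda>r. {r * T..<r * T + T}"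
  interpret P: prob_space ?P by (rule prob_samples)
  have K: "?K r \<subseteq> {..<m}" if "r < R" for r
  proof -
    have "Suc r * T \<le> R * T" using that by (intro mult_right_mono) auto
    with R(1) show ?thesis by auto
  qed
  have disj: "disjoint_family_on ?K {..<R}"
    unfolding disjoint_family_on_def
  proof (intro ballI impI)
    fix r s :: nat assume "r \<noteq> s"
    have "x div T = r'" if "x \<in> ?K r'" for x r'
      using that T by (auto intro!: div_nat_eqI simp: algebra_simps)
    with \<open>r \<noteq> s\<close> show "?K r \<inter> ?K s = {}" by (metis disjoint_iff)
  qed
  have ind: "P.indep_vars (\<lambda>_. borel) (\<lambda>r S. block_error lam T r S) {..<R}"
  proof -
    have "P.indep_vars (\<lambda>_. D) (\<lambda>i S. S i) {..<m}"
    proof (subst P.indep_vars_iff_distr_eq_PiM')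
      show "{..<m} \<noteq> {}" using R T by (cases m) auto
      have "distr ?P ?P (\<lambda>S. \<lambda>i\<in>{..<m}. S i) = distr ?P ?P (\<lambda>S. S)"
        by (intro distr_cong refl) (auto simp: space_PiM)
      also have "\<dots> = (\<Pi>\<^sub>M i\<in>{..<m}. distr ?P D (\<lambda>S. S i))"
        unfolding distr_id2[OF refl]
        by (intro PiM_cong refl distr_PiM_component[symmetric] prob_space_axioms)
      finally show "distr ?P ?P (\<lambda>S. \<lambda>i\<in>{..<m}. S i) = (\<Pi>\<^sub>M i\<in>{..<m}. distr ?P D (\<lambda>S. S i))" .
    qed (auto intro: measurable_component_singleton)
    from P.indep_vars_restrict[OF this K disj]
    have "P.indep_vars (\<lambda>r. samples (?K r)) (\<lambda>r S. restrict S (?K r)) {..<R}" by simp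
    hence "P.indep_vars (\<lambda>_. borel) (\<lambda>r S. block_error lam T r (restrict S (?K r))) {..<R}"
      by (rule P.indep_vars_compose2) (rule block_error_measurable, simp)
    \<comment> \<open>A block error reads only its own range, so it factors through the restriction
      of the sample to that range.\<close>
    moreover have "block_error lam T r (restrict S (?K r)) = block_error lam T r S" for r S
    proof -
      have "predictor u n lam (\<lambda>s. restrict S (?K r) (r * T + s)) t = predictor u n lam (\<lambda>s. S (r * T + s)) t"
        if "t < T" for t using that by (intro predictor_cong) auto
      thus ?thesis unfolding block_error_def by simp
    qed
    ultimately show ?thesis by simp
  qed
  interpret H: Hoeffding_ineq ?P "{..<R}" "\<lambda>r S. block_error lam T r S" "\<lambda>_. 0" "\<lambda>_. 1"
    "\<Sum>r<R. P.expectation (\<lambda>S. block_error lam T r S)"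
    using ind block_error_range by unfold_locales auto
  have "(\<Sum>r<R. P.expectation (\<lambda>S. block_error lam T r S)) \<le> (\<Sum>r<R. \<epsilon> / 2)"
    using expected_block_error[OF c lam T K] small by (intro sum_mono) (force intro: order_trans)
  hence "{S \<in> space ?P. real R * (3 * \<epsilon> / 4) \<le> (\<Sum>r<R. block_error lam T r S)}
    \<subseteq> {S \<in> space ?P. (\<Sum>r<R. P.expectation (\<lambda>S. block_error lam T r S)) + real R * \<epsilon> / 4 \<le> (\<Sum>r<R. block_error lam T r S)}"
    by (auto simp: field_simps)
  hence "P.prob {S \<in> space ?P. real R * (3 * \<epsilon> / 4) \<le> (\<Sum>r<R. block_error lam T r S)}
    \<le> P.prob {S \<in> space ?P. (\<Sum>r<R. P.expectation (\<lambda>S. block_error lam T r S)) + real R * \<epsilon> / 4 \<le> (\<Sum>r<R. block_error lam T r S)}"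
  proof (rule P.finite_measure_mono)
    have [measurable]: "(\<lambda>S. \<Sum>r<R. block_error lam T r S) \<in> borel_measurable ?P"
      by (intro borel_measurable_sum block_error_measurable K) auto
    show "{S \<in> space ?P. (\<Sum>r<R. P.expectation (\<lambda>S. block_error lam T r S)) + real R * \<epsilon> / 4 \<le> (\<Sum>r<R. block_error lam T r S)}
      \<in> sets ?P" by measurable
  qed
  \<comment> \<open>With \<open>R\<close> variables of range 1, the exponent is -2 (R \<epsilon> /
    4)^2 / R, which is -R \<epsilon>^2 / 8.\<close>
  also have "\<dots> \<le> exp (- 2 * (real R * \<epsilon> / 4)\<^sup>2 / (\<Sum>r<R. (1 - 0)\<^sup>2))"
    using R \<epsilon> by (intro H.Hoeffding_ineq_ge) auto
  also have "- 2 * (real R * \<epsilon> / 4)\<^sup>2 / (\<Sum>r<R. (1 - 0)\<^sup>2) = - (real R * \<epsilon>\<^sup>2 / 8)"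
    using R by (simp add: power2_eq_square)
  finally show ?thesis .
qed

section \<open>From block errors to the averaged predictor\<close>

lemma iterate_measurable [measurable]: "iterate u n lam T S i \<in> borel_measurable (vec_space n)"
  unfolding iterate_def by measurable

lemma averaged_measurable [measurable]: "averaged u n lam T m S \<in> borel_measurable (vec_space n)"
  unfolding averaged_def by measurable

lemma averaged_range: "0 \<le> averaged u n lam T m S x \<and> averaged u n lam T m S x \<le> 1"
proof -
  have "(\<Sum>i\<le>m. u (iterate u n lam T S i x)) \<le> (\<Sum>i\<le>m. 1)" by (intro sum_mono u_range)
  thus ?thesis unfolding averaged_def by (auto intro!: divide_nonneg_nonneg sum_nonneg u_range)
qed

lemma mean_square_error_iff:
  "mean_square_error_le D (averaged u n lam T m S) (net2 u n k a b) \<epsilon> \<longleftrightarrow>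
   squared_error (averaged u n lam T m S) \<le> \<epsilon>"
  unfolding mean_square_error_le_def net2_eq squared_error_def
  using squared_error_range(1)[OF averaged_measurable averaged_range] by simp

lemma averaged_error_measurable:
  "(\<lambda>S. squared_error (averaged u n lam T m S)) \<in> borel_measurable (samples {..<m})"
proof -
  have [measurable]: "(\<lambda>(S, z). iterate u n lam T S i (fst z)) \<in> borel_measurable (samples {..<m} \<Otimes>\<^sub>M D)"
    if "i \<le> m" for i
    unfolding iterate_def
  proof (rule predictor_sample_measurable)
    fix s assume "s < i mod T"
    \<comment> \<open>Iterate \<open>i\<close> reads only samples with index below \<open>i\<close>,
      and \<open>i \<le> m\<close>.\<close>
    hence "i div T * T + s < i" using div_mult_mod_eq[of i T] by linarith
    thus "i div T * T + s \<in> {..<m}" using that by simp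
  qed
  have "(\<lambda>(S, z). (averaged u n lam T m S (fst z) - u (target (fst z)))\<^sup>2) \<in> borel_measurable (samples {..<m} \<Otimes>\<^sub>M D)"
    unfolding averaged_def by measurable
  thus ?thesis unfolding squared_error_def by (rule borel_measurable_lebesgue_integral)
qed

text \<open>Convexity of the square, in the form of the Cauchy-Schwarz inequality against the
  constant 1.\<close>

lemma averaged_error_le:
  "squared_error (averaged u n lam T m S)
     \<le> (\<Sum>i\<le>m. squared_error (\<lambda>x. u (iterate u n lam T S i x))) / (real m + 1)"
proof -
  have int: "integrable D (\<lambda>z. (u (iterate u n lam T S i (fst z)) - u (target (fst z)))\<^sup>2)" for i
    using u_range by (intro squared_error_range(1)) auto
  have "squared_error (averaged u n lam T m S)
    \<le> (\<integral>z. (\<Sum>i\<le>m. (u (iterate u n lam T S i (fst z)) - u (target (fst z)))\<^sup>2) / (real m + 1) \<partial>D)"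
    unfolding squared_error_def
  proof (rule integral_mono)
    fix z
    define d where "d i = u (iterate u n lam T S i (fst z)) - u (target (fst z))" for i
    have "averaged u n lam T m S (fst z) - u (target (fst z)) = (\<Sum>i\<le>m. d i * 1) / (real m + 1)"
      by (simp add: averaged_def d_def sum_subtractf field_simps)
    also have "\<dots>\<^sup>2 = (\<Sum>i\<le>m. d i * 1)\<^sup>2 / (real m + 1)\<^sup>2" by (rule power_divide)
    also have "\<dots> \<le> (\<Sum>i\<le>m. (d i)\<^sup>2) * (\<Sum>i\<le>m. 1\<^sup>2) / (real m + 1)\<^sup>2"
      by (intro divide_right_mono Cauchy_Schwarz_ineq_sum) simp
    also have "\<dots> = (\<Sum>i\<le>m. (d i)\<^sup>2) / (real m + 1)" by (simp add: power2_eq_square add.commute)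
    finally show "(averaged u n lam T m S (fst z) - u (target (fst z)))\<^sup>2
      \<le> (\<Sum>i\<le>m. (u (iterate u n lam T S i (fst z)) - u (target (fst z)))\<^sup>2) / (real m + 1)"
      by (simp add: d_def)
  qed (use int squared_error_range(1)[OF averaged_measurable averaged_range] in auto)
  also have "\<dots> = (\<Sum>i\<le>m. squared_error (\<lambda>x. u (iterate u n lam T S i x))) / (real m + 1)"
    unfolding squared_error_def using int by (simp add: Bochner_Integration.integral_sum)
  finally show ?thesis .
qed

text \<open>The \<open>m + 1\<close> iterates split into \<open>R\<close> full blocks and at most
  \<open>T\<close> remaining ones, each of error at most 1.\<close>

lemma sum_iterate_errors_le:
  assumes T: "0 < T" and R: "R = m div T"
  shows "(\<Sum>i\<le>m. squared_error (\<lambda>x. u (iterate u n lam T S i x)))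
     \<le> real T * (\<Sum>r<R. block_error lam T r S) + real T"
proof -
  let ?e = "\<lambda>i. squared_error (\<lambda>x. u (iterate u n lam T S i x))"
  have e: "?e i \<le> 1" for i using u_range by (intro squared_error_range; simp)
  have RT: "R * T \<le> m" "m < R * T + T"
    using div_mult_mod_eq[of m T] mod_less_divisor[OF T, of m] unfolding R by linarith+
  have "(\<Sum>i<R' * T. ?e i) = real T * (\<Sum>r<R'. block_error lam T r S)" for R'
  proof (induction R')
    case (Suc R')
    have un: "{..<Suc R' * T} = {..<R' * T} \<union> {R' * T..<R' * T + T}" by auto
    have "sum ?e ({..<R' * T} \<union> {R' * T..<R' * T + T})
        = (\<Sum>i<R' * T. ?e i) + (\<Sum>i\<in>{R' * T..<R' * T + T}. ?e i)"
      by (rule sum.union_disjoint) auto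
    hence "(\<Sum>i<Suc R' * T. ?e i) = (\<Sum>i<R' * T. ?e i) + (\<Sum>i\<in>{R' * T..<R' * T + T}. ?e i)"
      unfolding un .
    also have "(\<Sum>i\<in>{R' * T..<R' * T + T}. ?e i) = (\<Sum>t<T. ?e (R' * T + t))"
      by (rule sum.reindex_bij_witness[of _ "\<lambda>t. R' * T + t" "\<lambda>i. i - R' * T"]) auto
    also have "\<dots> = real T * block_error lam T R' S"
      using T by (simp add: block_error_def iterate_def)
    finally show ?case using Suc.IH by (simp add: algebra_simps)
  qed simp
  moreover have "(\<Sum>i\<le>m. ?e i) = (\<Sum>i<R * T. ?e i) + (\<Sum>i\<in>{R * T..m}. ?e i)"
  proof -
    have un: "{..m} = {..<R * T} \<union> {R * T..m}" using RT by auto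
    have "sum ?e ({..<R * T} \<union> {R * T..m}) = (\<Sum>i<R * T. ?e i) + (\<Sum>i\<in>{R * T..m}. ?e i)"
      by (rule sum.union_disjoint) auto
    thus ?thesis unfolding un .
  qed
  moreover have "(\<Sum>i\<in>{R * T..m}. ?e i) \<le> real T"
  proof -
    have "(\<Sum>i\<in>{R * T..m}. ?e i) \<le> (\<Sum>i\<in>{R * T..m}. 1)" by (intro sum_mono e)
    also have "\<dots> = real (card {R * T..m})" by (simp only: sum_constant mult_1_right)
    also have "\<dots> \<le> real T" using RT by (intro of_nat_mono) simp
    finally show ?thesis .
  qed
  ultimately show ?thesis by simp
qed

text \<open>With step size 0 all iterates vanish and the hypothesis is the constant
  \<open>u 0\<close>. By the Lipschitz condition its squared error is at most
  \<open>L\<^sup>2\<close> times the square of the inner layer, and \<open>inner_layer_bound\<close>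
  applies.\<close>

lemma constant_hypothesis:
  assumes "9 * L * L * real k \<le> 16 * \<epsilon>"
  shows "squared_error (averaged u n (step_size k L \<epsilon>) T m S) \<le> \<epsilon>"
proof -
  have "predictor u n 0 S' t = (\<lambda>x. 0)" for S' t by (induction t) auto
  hence "averaged u n (step_size k L \<epsilon>) T m S = (\<lambda>x. u 0)"
    using assms by (auto simp: averaged_def iterate_def step_size_def fun_eq_iff field_simps)
  moreover have "(\<integral>z. (u 0 - u (target (fst z)))\<^sup>2 \<partial>D) \<le> (\<integral>z. \<epsilon> \<partial>D)"
  proof (rule integral_mono_AE)
    show "integrable D (\<lambda>z. (u 0 - u (target (fst z)))\<^sup>2)"
      using u_range by (intro squared_error_range(1)[of "\<lambda>x. u 0"]) auto
    show "AE z in D. (u 0 - u (target (fst z)))\<^sup>2 \<le> \<epsilon>"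
      using AE_sphere
    proof eventually_elim
      case (elim z)
      have "\<bar>u 0 - u (target (fst z))\<bar> \<le> L * \<bar>target (fst z)\<bar>"
        using activation by (auto simp: activation_def dist_real_def dest!: lipschitz_onD[of L UNIV u 0 "target (fst z)"])
      hence "\<bar>u 0 - u (target (fst z))\<bar>\<^sup>2 \<le> (L * \<bar>target (fst z)\<bar>)\<^sup>2" by (intro power_mono) auto
      also have "\<dots> = L\<^sup>2 * (target (fst z))\<^sup>2" by (simp add: power_mult_distrib)
      also have "\<dots> \<le> L\<^sup>2 * (9 / 16 * real k)"
      proof (intro mult_left_mono)
        have "16 * (target (fst z))\<^sup>2 \<le> 9 * real k"
          unfolding target_def using elim by (intro inner_layer_bound b a) auto
        thus "(target (fst z))\<^sup>2 \<le> 9 / 16 * real k" by simp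
      qed simp
      also have "\<dots> \<le> \<epsilon>" using assms by (simp add: power2_eq_square)
      finally show ?case by simp
    qed
  qed simp
  ultimately show ?thesis by (simp add: squared_error_def prob_space)
qed

end

section \<open>Sample size and the learning guarantee\<close>

lemma sample_size_suffices:
  fixes L \<epsilon> \<theta> \<theta>\<^sub>0 :: real
  assumes large: "16 * \<epsilon> < 9 * L * L * real k" and \<epsilon>: "0 < \<epsilon>" "\<epsilon> < 1" and k: "1 \<le> k" and L: "0 \<le> L"
    and C: "(real A + 1) * (8 + 4 / \<theta>\<^sub>0) \<le> (4 / 3) ^ C" and \<theta>: "0 < \<theta>\<^sub>0" "\<theta>\<^sub>0 \<le> \<theta>"
    and m: "(real k * L / \<epsilon>) ^ (C + 6) * \<theta> \<le> m"
  shows "real (block_length (block_bound A k L \<epsilon>)) * ((8 * \<theta> + 4) / \<epsilon>\<^sup>2) \<le> m"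
proof -
  \<comment> \<open>Everything is bounded by powers of \<open>c\<close>: the block length by
    \<open>(A + 1) * c\<^sup>2\<close> and \<open>1 / \<epsilon>\<^sup>2\<close> by
    \<open>c ^ 4\<close>, which gives the exponent 6. The remaining constants are absorbed by
    \<open>c ^ C\<close>.\<close>
  define c where "c = real k * L / \<epsilon>"
  have c0: "0 \<le> c" using \<epsilon> L by (simp add: c_def)
  have kk: "L * L * real k \<le> (real k * L)\<^sup>2"
    using k mult_right_mono[of 1 "real k" "L * L * real k"] L by (simp add: power2_eq_square mult_ac)
  have "\<epsilon> * \<epsilon> \<le> \<epsilon>" using \<epsilon> by (simp add: mult_left_le)
  hence "16 / 9 * \<epsilon>\<^sup>2 \<le> (real k * L)\<^sup>2" using large kk by (simp add: power2_eq_square)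
  hence "(4 / 3)\<^sup>2 \<le> c\<^sup>2" using \<epsilon> by (simp add: c_def power_divide field_simps)
  hence c43: "4 / 3 \<le> c" using c0 by (rule power2_le_imp_le)
  have "\<epsilon> \<le> (real k * L)\<^sup>2" using large kk \<epsilon> by linarith
  \<comment> \<open>Dividing \<epsilon> \<le> (k L)^2 by \<epsilon>^2 gives the bound by
    \<open>c\<^sup>2\<close>.\<close>
  hence inv: "1 / \<epsilon> \<le> c\<^sup>2" using \<epsilon> by (simp add: c_def power_divide field_simps power2_eq_square)
  have "block_bound A k L \<epsilon> = real A * (L * L * real k / \<epsilon>\<^sup>2)"
    by (simp add: block_bound_def power2_eq_square)
  also have "\<dots> \<le> real A * c\<^sup>2"
    unfolding c_def power_divide using kk by (intro mult_left_mono divide_right_mono) auto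
  finally have "block_bound A k L \<epsilon> \<le> real A * c\<^sup>2" .
  moreover have "0 \<le> block_bound A k L \<epsilon>" using L \<epsilon> by (simp add: block_bound_def)
  moreover have "1 \<le> c\<^sup>2" using c43 by (simp add: one_le_power)
  ultimately have T: "real (block_length (block_bound A k L \<epsilon>)) \<le> (real A + 1) * c\<^sup>2"
    unfolding block_length_def distrib_right by (auto simp: max_def) linarith+
  have "(8 * \<theta> + 4) / \<epsilon>\<^sup>2 = (1 / \<epsilon>)\<^sup>2 * (8 * \<theta> + 4)" by (simp add: power_divide)
  \<comment> \<open>The summand 4 is at most \<open>4 / \<theta>\<^sub>0 * \<theta>\<close>, since
    \<theta> is bounded below.\<close>
  also have "\<dots> \<le> (c\<^sup>2)\<^sup>2 * ((8 + 4 / \<theta>\<^sub>0) * \<theta>)"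
    using inv \<epsilon> \<theta> by (intro mult_mono power_mono) (auto simp: field_simps)
  finally have "real (block_length (block_bound A k L \<epsilon>)) * ((8 * \<theta> + 4) / \<epsilon>\<^sup>2)
    \<le> ((real A + 1) * c\<^sup>2) * ((c\<^sup>2)\<^sup>2 * ((8 + 4 / \<theta>\<^sub>0) * \<theta>))"
    using T \<theta> by (intro mult_mono) auto
  also have "\<dots> = ((real A + 1) * (8 + 4 / \<theta>\<^sub>0)) * (c ^ 6 * \<theta>)"
    by (simp add: mult_ac flip: power_mult power_add)
  also have "\<dots> \<le> c ^ C * (c ^ 6 * \<theta>)"
    using C c0 c43 \<theta> power_mono[OF c43, of C] by (intro mult_right_mono) auto
  also have "\<dots> \<le> m" using m by (simp add: c_def power_add mult_ac)
  finally show ?thesis .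
qed

text \<open>The error budget \<epsilon> is split into \<epsilon>/2 for the mean of the block errors,
  \<epsilon>/4 for their deviation and \<epsilon>/4 for the incomplete last block.\<close>

lemma (in network_distribution) learning_guarantee:
  assumes c: "summable (\<lambda>d. (c d)\<^sup>2 * 2 ^ d)"
      "\<And>z. \<bar>z\<bar> \<le> 1 \<Longrightarrow> (\<lambda>d. c d * z ^ d) sums sigmoid z"
    and A: "8 * (\<Sum>d. (c d)\<^sup>2 * 2 ^ d) \<le> real A"
    and \<delta>: "0 < \<delta>" "\<delta> \<le> \<delta>\<^sub>0" "\<delta>\<^sub>0 < 1" and \<epsilon>: "0 < \<epsilon>" and k: "1 \<le> k"
    and C: "(real A + 1) * (8 + 4 / ln (1 / \<delta>\<^sub>0)) \<le> (4 / 3) ^ C"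
    and m: "(real k * L / \<epsilon>) ^ (C + 6) * ln (1 / \<delta>) \<le> real m"
  shows "1 - \<delta> \<le> measure (samples {..<m}) {S \<in> space (samples {..<m}).
     mean_square_error_le D (hypothesis A u n k L \<epsilon> \<delta> m S) (net2 u n k a b) \<epsilon>}"
proof -
  interpret P: prob_space "samples {..<m}" by (rule prob_samples)
  let ?lam = "step_size k L \<epsilon>" and ?\<beta> = "block_bound A k L \<epsilon>"
  let ?T = "block_length ?\<beta>"
  let ?err = "\<lambda>S. squared_error (averaged u n ?lam ?T m S)"
  have L: "0 \<le> L" using activation lipschitz_on_nonneg by (auto simp: activation_def)
  have eq: "{S \<in> space (samples {..<m}). mean_square_error_le D (hypothesis A u n k L \<epsilon> \<delta> m S) (net2 u n k a b) \<epsilon>}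
    = {S \<in> space (samples {..<m}). ?err S \<le> \<epsilon>}"
    by (simp add: hypothesis_def mean_square_error_iff)
  note [measurable] = averaged_error_measurable
  show ?thesis
  \<comment> \<open>In the first case every sample is good: either the constant \<open>u 0\<close>
    suffices, or \<epsilon> is at least 1, which bounds the error of any predictor with values in
    \<open>[0, 1]\<close>.\<close>
  proof (cases "9 * L * L * real k \<le> 16 * \<epsilon> \<or> 1 \<le> \<epsilon>")
    case True
    have "?err S \<le> \<epsilon>" for S
      using True constant_hypothesis[of \<epsilon> ?T m S]
        squared_error_range(3)[OF averaged_measurable averaged_range, of ?lam ?T m S] by auto
    hence "{S \<in> space (samples {..<m}). ?err S \<le> \<epsilon>} = space (samples {..<m})" by auto
    thus ?thesis unfolding eq using \<delta> by (simp add: P.prob_space)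
  next
    case False
    define \<theta> where "\<theta> = ln (1 / \<delta>)"
    define R where "R = m div ?T"
    have large: "16 * \<epsilon> < 9 * L * L * real k" and \<epsilon>1: "\<epsilon> < 1" using False by auto
    have Lpos: "0 < L" using large \<epsilon> L by (cases "L = 0") auto
    have lam: "?lam = \<epsilon> / (4 * L)" "0 < ?lam" using large Lpos \<epsilon> by (auto simp: step_size_def)
    have T: "0 < ?T" "?\<beta> \<le> real ?T" unfolding block_length_def by (auto simp: le_max_iff_disj) linarith
    have \<theta>0: "0 < ln (1 / \<delta>\<^sub>0)" "ln (1 / \<delta>\<^sub>0) \<le> \<theta>" unfolding \<theta>_def using \<delta> by (auto simp: frac_le)
    have "real ?T * ((8 * \<theta> + 4) / \<epsilon>\<^sup>2) \<le> real m"
      using sample_size_suffices[OF large \<epsilon> \<epsilon>1 k L C \<theta>0] m by (simp add: \<theta>_def)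
    hence size: "(8 * \<theta> + 4) / \<epsilon>\<^sup>2 \<le> real m / real ?T" using T by (simp add: field_simps)
    have \<epsilon>2: "\<epsilon>\<^sup>2 \<le> \<epsilon>" "0 < \<epsilon>\<^sup>2" using \<epsilon> \<epsilon>1 by (auto simp: power2_eq_square mult_left_le)
    have "real m / real ?T \<le> real R + 1"
    proof -
      have "m \<le> (R + 1) * ?T"
        using div_mult_mod_eq[of m ?T] mod_less_divisor[OF T(1), of m] unfolding R_def distrib_right by linarith
      hence "real m \<le> (real R + 1) * real ?T" by (metis of_nat_le_iff of_nat_mult of_nat_Suc Suc_eq_plus1 add.commute)
      thus ?thesis using T by (simp add: field_simps)
    qed
    with size have "8 * \<theta> / \<epsilon>\<^sup>2 + 4 / \<epsilon>\<^sup>2 \<le> real R + 1" by (simp add: add_divide_distrib)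
    \<comment> \<open>The summand 4 in the sample size pays for the rounding in
      \<open>R = m div T\<close>; below it also makes \<open>T\<close> small against
      \<open>m\<close>.\<close>
    moreover have "4 \<le> 4 / \<epsilon>\<^sup>2" using \<epsilon>2 \<epsilon>1 by (simp add: field_simps)
    ultimately have R\<theta>: "8 * \<theta> / \<epsilon>\<^sup>2 < real R" by linarith
    have R0: "0 < R"
    proof -
      have "0 \<le> 8 * \<theta> / \<epsilon>\<^sup>2" using \<theta>0 by simp
      with R\<theta> show ?thesis by linarith
    qed
    have "real ?T * (4 / \<epsilon>) \<le> real ?T * ((8 * \<theta> + 4) / \<epsilon>\<^sup>2)"
      using \<epsilon> \<epsilon>2 \<theta>0 by (intro mult_left_mono frac_le) auto
    also have "\<dots> \<le> real m" by fact
    finally have Tm: "real ?T \<le> \<epsilon> / 4 * real m" using \<epsilon> by (simp add: field_simps)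
    have "\<theta> \<le> real R * \<epsilon>\<^sup>2 / 8" using R\<theta> \<epsilon>2 by (simp add: field_simps)
    hence exp_le: "exp (- (real R * \<epsilon>\<^sup>2 / 8)) \<le> \<delta>"
      using \<delta> exp_le_cancel_iff[of "- (real R * \<epsilon>\<^sup>2 / 8)" "- \<theta>"]
      by (simp add: \<theta>_def exp_minus ln_div)
    let ?V = "(\<Sum>d. (c d)\<^sup>2 * 2 ^ d) * real k"
    let ?bad = "{S \<in> space (samples {..<m}). real R * (3 * \<epsilon> / 4) \<le> (\<Sum>r<R. block_error ?lam ?T r S)}"
    have "P.prob ?bad \<le> exp (- (real R * \<epsilon>\<^sup>2 / 8))"
    proof (rule block_errors_concentrate[OF c lam(2) T(1) _ R0 \<epsilon>])
      show "R * ?T \<le> m" unfolding R_def by simp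
      \<comment> \<open>This is where \<open>A\<close> and the block length come from: 8 times the
        squared norm is at most \<open>A * k\<close>, which brings the norm term of the error bound
        down to \<open>\<epsilon> / 4\<close>. The other \<open>\<epsilon> / 4\<close> is
        \<open>L\<close> times the step size.\<close>
      have "8 * L\<^sup>2 * ?V \<le> real A * (L\<^sup>2 * real k)"
        using mult_right_mono[OF A, of "L\<^sup>2 * real k"] by (simp add: mult_ac)
      also have "\<dots> = \<epsilon>\<^sup>2 * ?\<beta>" using \<epsilon> by (simp add: block_bound_def power2_eq_square)
      also have "\<dots> \<le> \<epsilon>\<^sup>2 * real ?T" using T by (intro mult_left_mono) auto
      finally have "2 * L\<^sup>2 * ?V / (\<epsilon> * real ?T) \<le> \<epsilon> / 4"
        using \<epsilon> T(1) by (simp add: field_simps power2_eq_square)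
      moreover have "L * (V / (2 * ?lam * t) + ?lam) = 2 * L\<^sup>2 * V / (\<epsilon> * t) + \<epsilon> / 4" for V t
        unfolding lam(1) using Lpos by (simp add: distrib_left power2_eq_square)
      ultimately show "L * (?V / (2 * ?lam * real ?T) + ?lam) \<le> \<epsilon> / 2" by simp
    qed
    hence bad: "P.prob ?bad \<le> \<delta>" using exp_le by linarith
    have good: "?err S \<le> \<epsilon>" if "\<not> real R * (3 * \<epsilon> / 4) \<le> (\<Sum>r<R. block_error ?lam ?T r S)" for S
    proof -
      have "real ?T * (\<Sum>r<R. block_error ?lam ?T r S) \<le> real ?T * (real R * (3 * \<epsilon> / 4))"
        using that by (intro mult_left_mono) auto
      also have "\<dots> = real (R * ?T) * (3 * \<epsilon> / 4)" by simp
      also have "\<dots> \<le> real m * (3 * \<epsilon> / 4)"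
        using \<epsilon> by (intro mult_right_mono of_nat_mono) (auto simp: R_def)
      \<comment> \<open>The full blocks contribute less than \<open>3 * \<epsilon> / 4 * m\<close>,
        the incomplete one at most \<open>T \<le> \<epsilon> / 4 * m\<close>.\<close>
      finally have "real ?T * (\<Sum>r<R. block_error ?lam ?T r S) + real ?T \<le> \<epsilon> * (real m + 1)"
        using Tm \<epsilon> by (simp add: algebra_simps)
      with sum_iterate_errors_le[OF T(1) R_def, of ?lam S]
      have "(\<Sum>i\<le>m. squared_error (\<lambda>x. u (iterate u n ?lam ?T S i x))) / (real m + 1) \<le> \<epsilon>"
        by (simp add: pos_divide_le_eq)
      with averaged_error_le[of ?lam ?T m S] show ?thesis by linarith
    qed
    have K: "{r * ?T..<r * ?T + ?T} \<subseteq> {..<m}" if "r < R" for r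
    proof -
      have "Suc r * ?T \<le> R * ?T" using that by (intro mult_right_mono) auto
      moreover have "R * ?T \<le> m" unfolding R_def by simp
      ultimately show ?thesis by auto
    qed
    have "(\<lambda>S. \<Sum>r<R. block_error ?lam ?T r S) \<in> borel_measurable (samples {..<m})"
      by (intro borel_measurable_sum block_error_measurable K) auto
    hence "?bad \<in> sets (samples {..<m})" by measurable
    hence "1 - \<delta> \<le> P.prob (space (samples {..<m}) - ?bad)" using bad by (simp add: P.prob_compl)
    also have "\<dots> \<le> P.prob {S \<in> space (samples {..<m}). ?err S \<le> \<epsilon>}"
      using good by (intro P.finite_measure_mono) auto
    finally show ?thesis unfolding eq .
  qed
qed

text \<open>As \<delta> approaches 1, \<open>ln (1 / \<delta>)\<close> vanishes, so constant factors
  are absorbed by the exponent only for \<delta> bounded away from 1. Hence \<open>C\<close> depends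
  on \<open>\<delta>\<^sub>0\<close>, while the programs and the time bound are fixed before
  it.\<close>

theorem theorem4:
  shows "\<exists>(learner :: com) (evaluator :: com) (p :: nat)
      (h :: (real \<Rightarrow> real) \<Rightarrow> nat \<Rightarrow> nat \<Rightarrow> real \<Rightarrow> real \<Rightarrow> real \<Rightarrow> nat \<Rightarrow> sample \<Rightarrow> vec \<Rightarrow> real).
    (\<forall>u n k L \<epsilon> \<delta> m S.
       n \<ge> 1 \<and> k \<ge> 1 \<and> activation L u \<and> \<epsilon> > 0 \<and> 0 < \<delta> \<and> \<delta> < 1 \<and>
       (\<forall>i<m. S i \<in> unit_sphere n \<times> {0..1}) \<longrightarrow>
       outputs_hypothesis learner evaluator u n k L \<epsilon> \<delta> m S
         (p * (m + n + 1) ^ p) (h u n k L \<epsilon> \<delta> m S)) \<and>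
    (\<forall>\<delta>\<^sub>0. 0 < \<delta>\<^sub>0 \<and> \<delta>\<^sub>0 < 1 \<longrightarrow>
      (\<exists>C :: nat. \<forall>u n k L \<epsilon> \<delta> m a b D.
        n \<ge> 1 \<and> k \<ge> 1 \<and> activation L u \<and> \<epsilon> > 0 \<and> 0 < \<delta> \<and> \<delta> \<le> \<delta>\<^sub>0 \<and>
        (\<forall>i<k. a i \<in> unit_sphere n) \<and> b \<in> unit_sphere k \<and>
        labelled_distribution n D \<and> conditional_mean n D (net2 u n k a b) \<and>
        real m \<ge> (real k * L / \<epsilon>) ^ C * ln (1 / \<delta>) \<longrightarrow>
        measure (PiM {..<m} (\<lambda>_. D))
          {S \<in> space (PiM {..<m} (\<lambda>_. D)).
             mean_square_error_le D (h u n k L \<epsilon> \<delta> m S) (net2 u n k a b) \<epsilon>}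
        \<ge> 1 - \<delta>))"
proof -
  obtain c :: "nat \<Rightarrow> real" where c: "summable (\<lambda>d. (c d)\<^sup>2 * 2 ^ d)"
    "\<And>z. \<bar>z\<bar> \<le> 1 \<Longrightarrow> (\<lambda>d. c d * z ^ d) sums sigmoid z"
    using sigmoid_power_series by auto
  \<comment> \<open>The sum depends only on the sigmoid, so a fixed natural number above it can be a
    constant of the learner.\<close>
  obtain A :: nat where A: "8 * (\<Sum>d. (c d)\<^sup>2 * 2 ^ d) \<le> real A"
    using real_arch_simple by blast
  show ?thesis
  proof (rule exI[of _ "learner A"], rule exI[of _ evaluator], rule exI[of _ 100],
      rule exI[of _ "hypothesis A"], intro conjI allI impI)
    fix u :: "real \<Rightarrow> real" and n k m :: nat and L \<epsilon> \<delta> :: real and S :: sample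
    assume "n \<ge> 1 \<and> k \<ge> 1 \<and> activation L u \<and> \<epsilon> > 0 \<and> 0 < \<delta> \<and> \<delta> < 1 \<and>
       (\<forall>i<m. S i \<in> unit_sphere n \<times> {0..1})"
    thus "outputs_hypothesis (learner A) evaluator u n k L \<epsilon> \<delta> m S
         (100 * (m + n + 1) ^ 100) (hypothesis A u n k L \<epsilon> \<delta> m S)"
      by (intro outputs_hypothesis) auto
  next
    fix \<delta>\<^sub>0 :: real assume \<delta>0: "0 < \<delta>\<^sub>0 \<and> \<delta>\<^sub>0 < 1"
    \<comment> \<open>The base \<open>4 / 3\<close> is the lower bound on
      \<open>k * L / \<epsilon>\<close> in the case where the learner has to leave the constant
      predictor and \<epsilon> < 1.\<close>
    obtain C :: nat where C: "(real A + 1) * (8 + 4 / ln (1 / \<delta>\<^sub>0)) \<le> (4 / 3) ^ C"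
      using real_arch_pow[of "4 / 3" "(real A + 1) * (8 + 4 / ln (1 / \<delta>\<^sub>0))"] by (auto intro: less_imp_le)
    show "\<exists>C :: nat. \<forall>u n k L \<epsilon> \<delta> m a b D.
        n \<ge> 1 \<and> k \<ge> 1 \<and> activation L u \<and> \<epsilon> > 0 \<and> 0 < \<delta> \<and> \<delta> \<le> \<delta>\<^sub>0 \<and>
        (\<forall>i<k. a i \<in> unit_sphere n) \<and> b \<in> unit_sphere k \<and>
        labelled_distribution n D \<and> conditional_mean n D (net2 u n k a b) \<and>
        real m \<ge> (real k * L / \<epsilon>) ^ C * ln (1 / \<delta>) \<longrightarrow>
        measure (PiM {..<m} (\<lambda>_. D))
          {S \<in> space (PiM {..<m} (\<lambda>_. D)).
             mean_square_error_le D (hypothesis A u n k L \<epsilon> \<delta> m S) (net2 u n k a b) \<epsilon>}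
        \<ge> 1 - \<delta>"
    proof (rule exI[of _ "C + 6"], intro allI impI, elim conjE)
      fix u :: "real \<Rightarrow> real" and n k m :: nat and L \<epsilon> \<delta> :: real
        and a :: "nat \<Rightarrow> vec" and b :: vec and D :: "(vec \<times> real) measure"
      assume *: "activation L u" "\<forall>i<k. a i \<in> unit_sphere n" "b \<in> unit_sphere k"
        "labelled_distribution n D" "conditional_mean n D (net2 u n k a b)"
        and **: "1 \<le> k" "0 < \<epsilon>" "0 < \<delta>" "\<delta> \<le> \<delta>\<^sub>0"
          "(real k * L / \<epsilon>) ^ (C + 6) * ln (1 / \<delta>) \<le> real m"
      interpret network_distribution n k L u a b D using * by unfold_locales auto
      show "1 - \<delta> \<le> measure (PiM {..<m} (\<lambda>_. D)) {S \<in> space (PiM {..<m} (\<lambda>_. D)).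
             mean_square_error_le D (hypothesis A u n k L \<epsilon> \<delta> m S) (net2 u n k a b) \<epsilon>}"
        using learning_guarantee[OF c A] \<delta>0 ** C by simp
    qed
  qed
qed

end
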